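(* Let $\mathcal{Q}_3=\mathbb{R}[\varepsilon]/(\varepsilon^8)$, let $\lambda_1,\dots,\lambda_8$ be the Gell-Mann matrices, and let $\Psi_{\mathcal{Q}_3}:\mathbb{P}(\mathcal{H}^3)\to\mathcal{Q}_3$ be the density map $$\Psi_{\mathcal{Q}_3}(\rho)=\left(\tfrac13+x_1\right)+x_2\varepsilon+x_3\varepsilon^2+x_4\varepsilon^3+x_5\varepsilon^4+x_6\varepsilon^5+x_7\varepsilon^6+x_8\varepsilon^7,\qquad x_n=\tfrac{\sqrt3}{2}\mathrm{Tr}(\rho\lambda_n).$$ Let $$\mathcal{V}_{\mathcal{Q}_3}=\left\{\left(\tfrac13+x_1\right)+\sum_{n=2}^8x_n\varepsilon^{n-1}\in\mathcal{Q}_3\ \middle|\ \sum_{n=1}^8x_n^2=1,\ \ \sum_{j,k=1}^8d_{jkl}x_jx_k=\tfrac{1}{\sqrt3}x_l\ \ \forall\, l\in\{1,\dots,8\}\right\}.$$ Then $\Psi_{\mathcal{Q}_3}$ defines a global smooth embedding and a smooth Riemannian diffeomorphism between the complex projective space $\mathbb{P}(\mathcal{H}^3)$, endowed with the Fubini–Study metric $\mathrm{d}s^2_{\mathrm{FS}}$, and the four-dimensional compact algebraic variety $\mathcal{V}_{\mathcal{Q}_3}$ embedded in $\mathcal{Q}_3$, where $\mathcal{Q}_3$ is endowed with its canonical metric $\mathrm{d}s^2_{\mathcal{Q}_3}=\mathrm{d}c_0^2+\mathrm{d}c_1^2+\dots+\mathrm{d}c_7^2$. When restricted to the tangent bundle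 $T\mathcal{V}_{\mathcal{Q}_3}$, the infinitesimal line elements satisfy the rigid, non-singular conformal relation $$\mathrm{d}s^2_{\mathcal{Q}_3}=3\,\mathrm{d}s^2_{\mathrm{FS}},$$ preserving quantum state fidelity monotonically without inducing polar coordinate or gauge-phase singularities across the entire manifold.
   Context: $\mathcal{H}^3=\mathbb{C}^3$, and $\mathbb{P}(\mathcal{H}^3)\cong\mathbb{CP}^2$ is the space of complex lines in $\mathbb{C}^3$. A point represented by a unit vector $|\psi\rangle$ is identified with the rank-one Hermitian projector $\rho=|\psi\rangle\langle\psi|$. The eight Gell-Mann matrices $\lambda_1,\dots,\lambda_8$ are the standard traceless Hermitian $3\times3$ matrices with $\mathrm{Tr}(\lambda_j\lambda_k)=2\delta_{jk}$, so that $\rho=\frac13\mathbb{I}_3+\frac1{\sqrt3}\sum_{n=1}^8x_n\lambda_n$. The totally symmetric coefficients $d_{jkl}$ are defined by $\lambda_j\lambda_k+\lambda_k\lambda_j=\frac43\delta_{jk}\mathbb{I}_3+2\sum_{l=1}^8d_{jkl}\lambda_l$. The Fubini–Study metric is normalized as $\mathrm{d}s^2_{\mathrm{FS}}=\langle \mathrm{d}\psi|\mathrm{d}\psi\rangle-|\langle\psi|\mathrm{d}\psi\rangle|^2=\frac12\mathrm{Tr}(\mathrm{d}\rho\,\mathrm{d}\rho)$. Elements of $\mathcal{Q}_3$ are written $\xi=c_0+c_1\varepsilon+\dots+c_7\varepsilon^7$ with $c_n\in\mathbb{R}$, and the eight-dimensional real vector space $\mathcal{Q}_3$ carries the Euclidean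 inner product for which $\{1,\varepsilon,\dots,\varepsilon^7\}$ is orthonormal. *)

theory Defs
  imports "HOL-Analysis.Analysis" "HOL-Computational_Algebra.Polynomial"
begin

section \<open>The truncated polynomial ring R[eps]/(eps^8) as a Euclidean space\<close>

quotient_type q3 = "real poly" / "\<lambda>p q. monom 1 8 dvd p - q"
proof (rule equivpI)
  show "reflp (\<lambda>p q :: real poly. monom 1 8 dvd p - q)"
    by (auto intro: reflpI)
  show "symp (\<lambda>p q :: real poly. monom 1 8 dvd p - q)"
    by (auto intro!: sympI simp: dvd_diff_commute)
  show "transp (\<lambda>p q :: real poly. monom 1 8 dvd p - q)"
  proof (rule transpI)
    fix p q r :: "real poly"
    assume "monom 1 8 dvd p - q" "monom 1 8 dvd q - r"
    then have "monom 1 8 dvd (p - q) + (q - r)" by (rule dvd_add)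
    then show "monom 1 8 dvd p - r" by simp
  qed
qed

instantiation q3 :: comm_ring_1
begin

lift_definition zero_q3 :: q3 is 0 .
lift_definition one_q3 :: q3 is 1 .

lift_definition plus_q3 :: "q3 \<Rightarrow> q3 \<Rightarrow> q3" is "(+)"
proof -
  fix p q r s :: "real poly"
  assume "monom 1 8 dvd p - q" "monom 1 8 dvd r - s"
  then have "monom 1 8 dvd (p - q) + (r - s)" by (rule dvd_add)
  then show "monom 1 8 dvd (p + r) - (q + s)" by (simp add: algebra_simps)
qed

lift_definition uminus_q3 :: "q3 \<Rightarrow> q3" is uminus
proof -
  fix p q :: "real poly"
  assume "monom 1 8 dvd p - q"
  then have "monom 1 8 dvd - (p - q)" by (simp only: dvd_minus_iff)
  then show "monom 1 8 dvd - p - - q" by (simp add: algebra_simps)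
qed

lift_definition minus_q3 :: "q3 \<Rightarrow> q3 \<Rightarrow> q3" is "(-)"
proof -
  fix p q r s :: "real poly"
  assume "monom 1 8 dvd p - q" "monom 1 8 dvd r - s"
  then have "monom 1 8 dvd (p - q) - (r - s)" by (rule dvd_diff)
  then show "monom 1 8 dvd (p - r) - (q - s)" by (simp add: algebra_simps)
qed

lift_definition times_q3 :: "q3 \<Rightarrow> q3 \<Rightarrow> q3" is "(*)"
proof -
  fix p q r s :: "real poly"
  assume "monom 1 8 dvd p - q" "monom 1 8 dvd r - s"
  then have "monom 1 8 dvd (p - q) * r + q * (r - s)" by (intro dvd_add dvd_mult dvd_mult2)
  then show "monom 1 8 dvd p * r - q * s" by (simp add: algebra_simps)
qed

instance
proof
  show "(0::q3) \<noteq> 1"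
  proof transfer
    have "coeff (1 :: real poly) 0 = 1" by simp
    then have "\<not> monom 1 8 dvd - (1 :: real poly)"
      unfolding dvd_minus_iff monom_1_dvd_iff' by (metis zero_less_numeral zero_neq_one)
    then show "\<not> monom 1 8 dvd 0 - (1 :: real poly)" by simp
  qed
qed (transfer; simp add: algebra_simps)+

end

lift_definition q3_coeff :: "q3 \<Rightarrow> nat \<Rightarrow> real" is "\<lambda>p n. if n < 8 then coeff p n else 0"
  by (auto simp: fun_eq_iff monom_1_dvd_iff')

lift_definition eps :: q3 is "monom 1 1" .

lemma q3_eqI: "(\<And>n. n < 8 \<Longrightarrow> q3_coeff x n = q3_coeff y n) \<Longrightarrow> x = y"
  by transfer (auto simp: monom_1_dvd_iff')

lemma eps_power: "eps ^ n = abs_q3 (monom 1 n)"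
proof (induction n)
  case 0
  show ?case by (simp add: one_q3.abs_eq)
next
  case (Suc n)
  have "eps ^ Suc n = abs_q3 (monom 1 1) * abs_q3 (monom 1 n)"
    using Suc by (simp add: eps_def)
  also have "\<dots> = abs_q3 (monom 1 (Suc n))"
    by (simp add: times_q3.abs_eq mult_monom)
  finally show ?case .
qed

lemma eps_power_8: "eps ^ 8 = 0"
  unfolding eps_power zero_q3.abs_eq q3.abs_eq_iff by simp

lemma q3_coeff_eps_power: "n < 8 \<Longrightarrow> q3_coeff (eps ^ k) n = (if n = k then 1 else 0)"
  unfolding eps_power by (auto simp: q3_coeff.abs_eq)

instantiation q3 :: real_algebra_1
begin

lift_definition scaleR_q3 :: "real \<Rightarrow> q3 \<Rightarrow> q3" is smult
proof -
  fix c :: real and p q :: "real poly"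
  assume "monom 1 8 dvd p - q"
  then have "monom 1 8 dvd smult c (p - q)" by (rule dvd_smult)
  then show "monom 1 8 dvd smult c p - smult c q" by (simp add: smult_diff_right)
qed

instance
  by standard (transfer; simp add: algebra_simps smult_add_right smult_add_left)+

end

lemma q3_coeff_simps [simp]:
  "q3_coeff 0 n = 0"
  "q3_coeff (x + y) n = q3_coeff x n + q3_coeff y n"
  "q3_coeff (x - y) n = q3_coeff x n - q3_coeff y n"
  "q3_coeff (- x) n = - q3_coeff x n"
  "q3_coeff (c *\<^sub>R x) n = c * q3_coeff x n"
  by (transfer; simp)+

instantiation q3 :: euclidean_space
begin

definition inner_q3 :: "q3 \<Rightarrow> q3 \<Rightarrow> real" where
  "inner_q3 x y = (\<Sum>n<8. q3_coeff x n * q3_coeff y n)"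

definition norm_q3 :: "q3 \<Rightarrow> real" where
  "norm_q3 x = sqrt (inner x x)"

definition dist_q3 :: "q3 \<Rightarrow> q3 \<Rightarrow> real" where
  "dist_q3 x y = norm (x - y)"

definition sgn_q3 :: "q3 \<Rightarrow> q3" where
  "sgn_q3 x = x /\<^sub>R norm x"

definition uniformity_q3 :: "(q3 \<times> q3) filter" where
  "uniformity_q3 = (INF e\<in>{0<..}. principal {(x, y). dist x y < e})"

definition open_q3 :: "q3 set \<Rightarrow> bool" where
  "open_q3 U \<longleftrightarrow> (\<forall>x\<in>U. \<forall>\<^sub>F (x', y) in uniformity. x' = x \<longrightarrow> y \<in> U)"

definition Basis_q3 :: "q3 set" where
  "Basis_q3 = (\<lambda>n. eps ^ n) ` {..<8}"

instance
proof
  fix x y z :: q3 and r :: real and U :: "q3 set"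
  show "dist x y = norm (x - y)" by (rule dist_q3_def)
  show "sgn x = x /\<^sub>R norm x" by (rule sgn_q3_def)
  show "uniformity = (INF e\<in>{0<..}. principal {(x::q3, y). dist x y < e})"
    by (rule uniformity_q3_def)
  show "open U \<longleftrightarrow> (\<forall>x\<in>U. \<forall>\<^sub>F (x', y) in uniformity. x' = x \<longrightarrow> y \<in> U)"
    by (rule open_q3_def)
  show "inner x y = inner y x" by (simp add: inner_q3_def mult.commute)
  show "inner (x + y) z = inner x z + inner y z"
    by (simp add: inner_q3_def algebra_simps sum.distrib)
  show "inner (r *\<^sub>R x) y = r * inner x y"
    by (simp add: inner_q3_def sum_distrib_left algebra_simps)
  show "0 \<le> inner x x" by (simp add: inner_q3_def sum_nonneg)
  show "inner x x = 0 \<longleftrightarrow> x = 0"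
  proof
    assume "inner x x = 0"
    then have "\<forall>n<8. q3_coeff x n = 0"
      by (simp add: inner_q3_def sum_nonneg_eq_0_iff)
    then show "x = 0" by (intro q3_eqI) simp
  qed (simp add: inner_q3_def)
  show "norm x = sqrt (inner x x)" by (rule norm_q3_def)
next
  have *: "inner x (eps ^ k) = q3_coeff x k" if "k < 8" for x :: q3 and k
  proof -
    have "inner x (eps ^ k) = (\<Sum>n<8. if n = k then q3_coeff x k else 0)"
      unfolding inner_q3_def by (intro sum.cong) (auto simp: q3_coeff_eps_power)
    then show ?thesis using that by simp
  qed
  have "eps ^ 0 \<in> Basis" unfolding Basis_q3_def by (rule imageI) simp
  then show "(Basis :: q3 set) \<noteq> {}" by blast
  show "finite (Basis :: q3 set)" by (simp add: Basis_q3_def)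
  fix u v :: q3
  assume uv: "u \<in> Basis" "v \<in> Basis"
  then obtain m n where mn: "u = eps ^ m" "m < 8" "v = eps ^ n" "n < 8"
    by (auto simp: Basis_q3_def)
  have "inner u v = (if n = m then 1 else 0)"
    using mn * [of n u] by (simp add: q3_coeff_eps_power)
  moreover have "u = v \<longleftrightarrow> n = m"
    using mn q3_coeff_eps_power [of n m] q3_coeff_eps_power [of n n] by (auto split: if_splits)
  ultimately show "inner u v = (if u = v then 1 else 0)" by simp
next
  have *: "inner x (eps ^ k) = q3_coeff x k" if "k < 8" for x :: q3 and k
  proof -
    have "inner x (eps ^ k) = (\<Sum>n<8. if n = k then q3_coeff x k else 0)"
      unfolding inner_q3_def by (intro sum.cong) (auto simp: q3_coeff_eps_power)
    then show ?thesis using that by simp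
  qed
  fix x :: q3
  show "(\<forall>u\<in>Basis. inner x u = 0) \<longleftrightarrow> x = 0"
  proof
    assume "\<forall>u\<in>Basis. inner x u = 0"
    then have "\<forall>n<8. q3_coeff x n = 0" by (auto simp: Basis_q3_def *)
    then show "x = 0" by (intro q3_eqI) simp
  qed (simp add: inner_q3_def)
qed

end


section \<open>Smooth manifolds, submanifolds of Euclidean space, Riemannian metrics\<close>

text \<open>
  \<open>smooth_on S f\<close> means that \<open>f\<close> is of class C-infinity on \<open>S\<close>; it is only used for open \<open>S\<close>.
\<close>

primrec Ck_on :: "nat \<Rightarrow> 'a::real_normed_vector set \<Rightarrow> ('a \<Rightarrow> 'b::real_normed_vector) \<Rightarrow> bool" where
  "Ck_on 0 S f \<longleftrightarrow> continuous_on S f"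
| "Ck_on (Suc k) S f \<longleftrightarrow>
     (\<forall>x\<in>S. f differentiable (at x)) \<and> (\<forall>v. Ck_on k S (\<lambda>x. frechet_derivative f (at x) v))"

definition smooth_on :: "'a::real_normed_vector set \<Rightarrow> ('a \<Rightarrow> 'b::real_normed_vector) \<Rightarrow> bool" where
  "smooth_on S f \<longleftrightarrow> (\<forall>k. Ck_on k S f)"

text \<open>
  A chart is a pair of a coordinate domain \<open>U\<close> and a coordinate map \<open>\<phi>\<close> (whose values outside
  \<open>U\<close> are irrelevant); the type \<open>'e\<close> is the model space, so \<open>DIM('e)\<close> is the dimension.
\<close>

type_synonym ('a, 'e) chart = "'a set \<times> ('a \<Rightarrow> 'e)"

definition smooth_atlas :: "'a topology \<Rightarrow> ('a, 'e::euclidean_space) chart set \<Rightarrow> bool" where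
  "smooth_atlas X A \<longleftrightarrow>
     (\<Union>(U, \<phi>)\<in>A. U) = topspace X \<and>
     (\<forall>(U, \<phi>)\<in>A. openin X U \<and> open (\<phi> ` U) \<and>
        homeomorphic_map (subtopology X U) (top_of_set (\<phi> ` U)) \<phi>) \<and>
     (\<forall>(U, \<phi>)\<in>A. \<forall>(W, \<psi>)\<in>A. smooth_on (\<phi> ` (U \<inter> W)) (\<psi> \<circ> inv_into U \<phi>))"

definition smooth_manifold :: "'a topology \<Rightarrow> ('a, 'e::euclidean_space) chart set \<Rightarrow> bool" where
  "smooth_manifold X A \<longleftrightarrow> Hausdorff_space X \<and> second_countable X \<and> smooth_atlas X A"

definition smooth_map ::
  "'a topology \<Rightarrow> ('a, 'e::euclidean_space) chart set \<Rightarrow>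
   'b topology \<Rightarrow> ('b, 'f::euclidean_space) chart set \<Rightarrow> ('a \<Rightarrow> 'b) \<Rightarrow> bool" where
  "smooth_map X A Y B f \<longleftrightarrow>
     continuous_map X Y f \<and>
     (\<forall>(U, \<phi>)\<in>A. \<forall>(W, \<psi>)\<in>B. smooth_on (\<phi> ` (U \<inter> f -` W)) (\<psi> \<circ> f \<circ> inv_into U \<phi>))"

definition diffeomorphism ::
  "'a topology \<Rightarrow> ('a, 'e::euclidean_space) chart set \<Rightarrow>
   'b topology \<Rightarrow> ('b, 'f::euclidean_space) chart set \<Rightarrow> ('a \<Rightarrow> 'b) \<Rightarrow> bool" where
  "diffeomorphism X A Y B f \<longleftrightarrow>
     bij_betw f (topspace X) (topspace Y) \<and>
     smooth_map X A Y B f \<and> smooth_map Y B X A (inv_into (topspace X) f)"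

definition chart_deriv ::
  "('a, 'e::euclidean_space) chart \<Rightarrow> ('b, 'f::euclidean_space) chart \<Rightarrow> ('a \<Rightarrow> 'b) \<Rightarrow> 'a \<Rightarrow> 'e \<Rightarrow> 'f" where
  "chart_deriv c d f p = frechet_derivative (snd d \<circ> f \<circ> inv_into (fst c) (snd c)) (at (snd c p))"

definition immersion ::
  "('a, 'e::euclidean_space) chart set \<Rightarrow> ('b, 'f::euclidean_space) chart set \<Rightarrow> ('a \<Rightarrow> 'b) \<Rightarrow> bool" where
  "immersion A B f \<longleftrightarrow>
     (\<forall>c\<in>A. \<forall>d\<in>B. \<forall>p. p \<in> fst c \<and> f p \<in> fst d \<longrightarrow> inj (chart_deriv c d f p))"

definition smooth_embedding ::
  "'a topology \<Rightarrow> ('a, 'e::euclidean_space) chart set \<Rightarrow>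
   'b topology \<Rightarrow> ('b, 'f::euclidean_space) chart set \<Rightarrow> ('a \<Rightarrow> 'b) \<Rightarrow> bool" where
  "smooth_embedding X A Y B f \<longleftrightarrow> smooth_map X A Y B f \<and> immersion A B f \<and> embedding_map X Y f"

definition euclidean_atlas :: "('e, 'e::euclidean_space) chart set" where
  "euclidean_atlas = {(UNIV, id)}"

text \<open>
  All charts of a subset \<open>S\<close> of a Euclidean space that are obtained from slice charts: an ambient
  diffeomorphism \<open>F\<close> from \<open>W\<close> to \<open>W'\<close> flattens \<open>S \<inter> W\<close> onto \<open>T \<inter> W'\<close> for a linear subspace \<open>T\<close>,
  which is then identified with the model space by a linear isomorphism \<open>L\<close>.  Thus \<open>S\<close> is an
  embedded submanifold of dimension \<open>DIM('e)\<close> iff these charts cover it, and its smooth structure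
  is the one they generate.
\<close>

definition submanifold_atlas :: "'a::euclidean_space set \<Rightarrow> ('a, 'e::euclidean_space) chart set" where
  "submanifold_atlas S = {(U, \<phi>). \<exists>W W' (F :: 'a \<Rightarrow> 'a) G T L.
     open W \<and> open W' \<and> U = S \<inter> W \<and>
     F ` W = W' \<and> G ` W' = W \<and> (\<forall>x\<in>W. G (F x) = x) \<and> (\<forall>y\<in>W'. F (G y) = y) \<and>
     smooth_on W F \<and> smooth_on W' G \<and>
     subspace T \<and> F ` U = T \<inter> W' \<and>
     linear L \<and> bij_betw L T UNIV \<and> (\<forall>x\<in>U. \<phi> x = L (F x))}"

text \<open>
  A metric assigns to each chart \<open>(U, \<phi>)\<close> and point \<open>p \<in> U\<close> the metric tensor at \<open>p\<close> in the
  coordinates of that chart; the last condition below is its tensorial transformation law.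
\<close>

type_synonym ('a, 'e) metric = "('a, 'e) chart \<Rightarrow> 'a \<Rightarrow> 'e \<Rightarrow> 'e \<Rightarrow> real"

definition riemannian_metric ::
  "('a, 'e::euclidean_space) chart set \<Rightarrow> ('a, 'e) metric \<Rightarrow> bool" where
  "riemannian_metric A g \<longleftrightarrow>
     (\<forall>c\<in>A. \<forall>p\<in>fst c. bilinear (g c p) \<and> (\<forall>u v. g c p u v = g c p v u) \<and>
        (\<forall>u. u \<noteq> 0 \<longrightarrow> g c p u u > 0)) \<and>
     (\<forall>(U, \<phi>)\<in>A. \<forall>u v. smooth_on (\<phi> ` U) (\<lambda>y. g (U, \<phi>) (inv_into U \<phi> y) u v)) \<and>
     (\<forall>c\<in>A. \<forall>d\<in>A. \<forall>p \<in> fst c \<inter> fst d. \<forall>u v.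
        g d p (chart_deriv c d id p u) (chart_deriv c d id p v) = g c p u v)"

text \<open>The restriction of the ambient Euclidean metric to the tangent bundle of a submanifold.\<close>

definition induced_metric :: "('a::euclidean_space, 'e::euclidean_space) metric" where
  "induced_metric c p u v =
     inner (frechet_derivative (inv_into (fst c) (snd c)) (at (snd c p)) u)
           (frechet_derivative (inv_into (fst c) (snd c)) (at (snd c p)) v)"

text \<open>The pullback along \<open>f\<close> of the metric \<open>h\<close> is \<open>k\<close> times the metric \<open>g\<close>.\<close>

definition conformal_with_factor ::
  "real \<Rightarrow> ('a, 'e::euclidean_space) chart set \<Rightarrow> ('a, 'e) metric \<Rightarrow>
   ('b, 'f::euclidean_space) chart set \<Rightarrow> ('b, 'f) metric \<Rightarrow> ('a \<Rightarrow> 'b) \<Rightarrow> bool" where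
  "conformal_with_factor k A g B h f \<longleftrightarrow>
     (\<forall>c\<in>A. \<forall>d\<in>B. \<forall>p. p \<in> fst c \<and> f p \<in> fst d \<longrightarrow>
        (\<forall>u v. h d (f p) (chart_deriv c d f p u) (chart_deriv c d f p v) = k * g c p u v))"

definition real_algebraic_set :: "'a::euclidean_space set \<Rightarrow> bool" where
  "real_algebraic_set S \<longleftrightarrow>
     (\<exists>P. finite P \<and> (\<forall>f\<in>P. real_polynomial_function f) \<and> S = {x. \<forall>f\<in>P. f x = 0})"


section \<open>The projective plane of complex lines\<close>

definition line :: "complex ^ 3 \<Rightarrow> (complex ^ 3) set" where
  "line \<psi> = vec.span {\<psi>}"

definition proj_space :: "(complex ^ 3) set set" where
  "proj_space = {L. vec.subspace L \<and> vec.dim L = 1}"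

text \<open>The quotient topology of \<open>v \<mapsto> line v\<close> on the nonzero vectors.\<close>

definition proj_topology :: "(complex ^ 3) set topology" where
  "proj_topology = topology (\<lambda>S. S \<subseteq> proj_space \<and> open {v. v \<noteq> 0 \<and> line v \<in> S})"

lemma openin_proj_topology:
  "openin proj_topology S \<longleftrightarrow> S \<subseteq> proj_space \<and> open {v. v \<noteq> 0 \<and> line v \<in> S}"
proof -
  have "istopology (\<lambda>S. S \<subseteq> proj_space \<and> open {v. v \<noteq> 0 \<and> line v \<in> S})"
    unfolding istopology_def
  proof (intro conjI allI impI)
    fix S T
    assume "S \<subseteq> proj_space \<and> open {v. v \<noteq> 0 \<and> line v \<in> S}"
      "T \<subseteq> proj_space \<and> open {v. v \<noteq> 0 \<and> line v \<in> T}"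
    moreover have "{v. v \<noteq> 0 \<and> line v \<in> S \<inter> T} =
        {v. v \<noteq> 0 \<and> line v \<in> S} \<inter> {v. v \<noteq> 0 \<and> line v \<in> T}" by auto
    ultimately show "S \<inter> T \<subseteq> proj_space" "open {v. v \<noteq> 0 \<and> line v \<in> S \<inter> T}" by auto
  next
    fix K
    assume K: "\<forall>S\<in>K. S \<subseteq> proj_space \<and> open {v. v \<noteq> 0 \<and> line v \<in> S}"
    have "{v. v \<noteq> 0 \<and> line v \<in> \<Union>K} = (\<Union>S\<in>K. {v. v \<noteq> 0 \<and> line v \<in> S})" by auto
    with K show "\<Union>K \<subseteq> proj_space" "open {v. v \<noteq> 0 \<and> line v \<in> \<Union>K}" by auto
  qed
  then show ?thesis by (simp add: proj_topology_def)
qed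

definition affine_lift :: "3 \<Rightarrow> complex ^ 2 \<Rightarrow> complex ^ 3" where
  "affine_lift i z =
     (if i = 1 then vector [1, z $ 1, z $ 2]
      else if i = 2 then vector [z $ 1, 1, z $ 2]
      else vector [z $ 1, z $ 2, 1])"

definition affine_chart :: "3 \<Rightarrow> ((complex ^ 3) set, complex ^ 2) chart" where
  "affine_chart i =
     ({L \<in> proj_space. \<exists>v\<in>L. v $ i \<noteq> 0}, \<lambda>L. THE z. affine_lift i z \<in> L)"

definition proj_atlas :: "((complex ^ 3) set, complex ^ 2) chart set" where
  "proj_atlas = range affine_chart"

definition braket :: "complex ^ 3 \<Rightarrow> complex ^ 3 \<Rightarrow> complex" where
  "braket \<psi> \<phi> = (\<Sum>i\<in>UNIV. cnj (\<psi> $ i) * \<phi> $ i)"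

definition ketbra :: "complex ^ 3 \<Rightarrow> complex ^ 3 ^ 3" where
  "ketbra \<psi> = (\<chi> i j. \<psi> $ i * cnj (\<psi> $ j))"

definition state_projector :: "(complex ^ 3) set \<Rightarrow> complex ^ 3 ^ 3" where
  "state_projector L = (THE \<rho>. \<exists>\<psi>\<in>L. norm \<psi> = 1 \<and> \<rho> = ketbra \<psi>)"

lemma line_unit_vector:
  assumes "norm \<psi> = 1" "\<phi> \<in> line \<psi>" "norm \<phi> = 1"
  shows "ketbra \<phi> = ketbra \<psi>"
proof -
  obtain c where c: "\<phi> = c *s \<psi>"
    using assms(2) by (auto simp: line_def vec.span_singleton)
  have "norm \<phi> = cmod c * norm \<psi>"
    unfolding c norm_vec_def L2_set_def
    by (simp add: norm_mult power_mult_distrib real_sqrt_mult flip: sum_distrib_left)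
  then have "c * cnj c = 1"
    using assms by (simp add: complex_norm_square [symmetric])
  then have "c * a * (cnj c * b) = a * b" for a b
    by (metis mult.assoc mult.commute mult.right_neutral)
  then show ?thesis
    by (simp add: ketbra_def c vec_eq_iff)
qed

lemma state_projector_line:
  assumes "norm \<psi> = 1"
  shows "state_projector (line \<psi>) = ketbra \<psi>"
  unfolding state_projector_def
proof (rule the_equality)
  have "\<psi> \<in> line \<psi>" by (simp add: line_def vec.span_base)
  then show "\<exists>\<phi>\<in>line \<psi>. norm \<phi> = 1 \<and> ketbra \<psi> = ketbra \<phi>" using assms by blast
qed (use assms line_unit_vector in blast)

text \<open>
  Polarisation of the line element of Fubini and Study: for \<open>a = b = d\<psi>\<close> this is
  \<open>\<langle>d\<psi>|d\<psi>\<rangle> - |\<langle>\<psi>|d\<psi>\<rangle>|\<^sup>2\<close>.  The metric evaluates it on any smooth local section of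
  unit vectors; the value does not depend on the section, which is what makes \<open>THE\<close> meaningful.
\<close>

definition fs_form :: "complex ^ 3 \<Rightarrow> complex ^ 3 \<Rightarrow> complex ^ 3 \<Rightarrow> real" where
  "fs_form \<psi> a b = Re (braket a b - braket a \<psi> * braket \<psi> b)"

definition fubini_study :: "((complex ^ 3) set, complex ^ 2) metric" where
  "fubini_study c p u v = (THE r. \<exists>V \<psi>.
     open V \<and> snd c p \<in> V \<and> V \<subseteq> snd c ` fst c \<and> smooth_on V \<psi> \<and>
     (\<forall>z\<in>V. norm (\<psi> z) = 1 \<and> \<psi> z \<in> inv_into (fst c) (snd c) z) \<and>
     r = fs_form (\<psi> (snd c p)) (frechet_derivative \<psi> (at (snd c p)) u)
                               (frechet_derivative \<psi> (at (snd c p)) v))"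


section \<open>Gell-Mann matrices, the density map and its image\<close>

definition gell_mann :: "nat \<Rightarrow> complex ^ 3 ^ 3" where
  "gell_mann n =
    (if n = 1 then vector [vector [0, 1, 0], vector [1, 0, 0], vector [0, 0, 0]]
     else if n = 2 then vector [vector [0, - \<i>, 0], vector [\<i>, 0, 0], vector [0, 0, 0]]
     else if n = 3 then vector [vector [1, 0, 0], vector [0, - 1, 0], vector [0, 0, 0]]
     else if n = 4 then vector [vector [0, 0, 1], vector [0, 0, 0], vector [1, 0, 0]]
     else if n = 5 then vector [vector [0, 0, - \<i>], vector [0, 0, 0], vector [\<i>, 0, 0]]
     else if n = 6 then vector [vector [0, 0, 0], vector [0, 0, 1], vector [0, 1, 0]]
     else if n = 7 then vector [vector [0, 0, 0], vector [0, 0, - \<i>], vector [0, \<i>, 0]]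
     else if n = 8 then
       (1 / sqrt 3) *\<^sub>R vector [vector [1, 0, 0], vector [0, 1, 0], vector [0, 0, - 2]]
     else 0)"

definition gell_mann_d :: "nat \<Rightarrow> nat \<Rightarrow> nat \<Rightarrow> real" where
  "gell_mann_d j k l = (THE c. \<exists>f :: nat \<Rightarrow> real.
     gell_mann j ** gell_mann k + gell_mann k ** gell_mann j =
       (4 / 3 * (if j = k then 1 else 0)) *\<^sub>R mat 1 + 2 *\<^sub>R (\<Sum>m=1..8. f m *\<^sub>R gell_mann m) \<and>
     c = f l)"

lemma gell_mann_span:
  fixes M :: "complex ^ 3 ^ 3"
  assumes tr: "trace M = 0" and herm: "\<And>i j. M $ i $ j = cnj (M $ j $ i)"
  shows "\<exists>f :: nat \<Rightarrow> real. M = (\<Sum>m=1..8. f m *\<^sub>R gell_mann m)"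
proof -
  define f :: "nat \<Rightarrow> real" where "f = (\<lambda>m.
    if m = 1 then Re (M$1$2) else if m = 2 then - Im (M$1$2)
    else if m = 3 then (Re (M$1$1) - Re (M$2$2)) / 2
    else if m = 4 then Re (M$1$3) else if m = 5 then - Im (M$1$3)
    else if m = 6 then Re (M$2$3) else if m = 7 then - Im (M$2$3)
    else - (sqrt 3 / 2) * Re (M$3$3))"
  have set: "{1..8::nat} = {1, 2, 3, 4, 5, 6, 7, 8}" by auto
  have im: "Im (M$1$1) = 0" "Im (M$2$2) = 0" "Im (M$3$3) = 0"
    using herm [of 1 1] herm [of 2 2] herm [of 3 3] by (auto simp: complex_eq_iff)
  have off: "M$2$1 = cnj (M$1$2)" "M$3$1 = cnj (M$1$3)" "M$3$2 = cnj (M$2$3)"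
    by (rule herm)+
  have re: "Re (M$3$3) = - Re (M$1$1) - Re (M$2$2)"
    using tr by (simp add: trace_def sum_3 complex_eq_iff)
  have "M = (\<Sum>m=1..8. f m *\<^sub>R gell_mann m)"
    unfolding set
    by (simp add: vec_eq_iff forall_3 f_def gell_mann_def complex_eq_iff off im re field_simps)
  then show ?thesis by blast
qed

lemma gell_mann_independent:
  assumes "(\<Sum>m=1..8. f m *\<^sub>R gell_mann m) = (\<Sum>m=1..8. g m *\<^sub>R gell_mann m)"
    and "l \<in> {1..8}"
  shows "f l = g l"
proof -
  have set: "{1..8::nat} = {1, 2, 3, 4, 5, 6, 7, 8}" by auto
  show ?thesis
    using assms unfolding set
    by (auto simp: vec_eq_iff forall_3 gell_mann_def complex_eq_iff field_simps)
qed

lemma gell_mann_trace: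
  assumes "j \<in> {1..8}" "k \<in> {1..8}"
  shows "trace (gell_mann j ** gell_mann k) = (if j = k then 2 else 0)"
proof -
  have set: "{1..8::nat} = {1, 2, 3, 4, 5, 6, 7, 8}" by auto
  have all: "\<forall>j\<in>{1..8}. \<forall>k\<in>{1..8}. trace (gell_mann j ** gell_mann k) = (if j = k then 2 else 0)"
    unfolding set ball_simps
    by (intro conjI;
        simp add: trace_def sum_3 matrix_matrix_mult_def gell_mann_def complex_eq_iff)
  then show ?thesis using assms by blast
qed

lemma gell_mann_d_relation:
  assumes "j \<in> {1..8}" "k \<in> {1..8}"
  shows "gell_mann j ** gell_mann k + gell_mann k ** gell_mann j =
    (4 / 3 * (if j = k then 1 else 0)) *\<^sub>R mat 1 +
    2 *\<^sub>R (\<Sum>l=1..8. gell_mann_d j k l *\<^sub>R gell_mann l)"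
proof -
  have set: "{1..8::nat} = {1, 2, 3, 4, 5, 6, 7, 8}" by auto
  let ?A = "gell_mann j ** gell_mann k + gell_mann k ** gell_mann j"
  let ?D = "(4 / 3 * (if j = k then 1 else 0)) *\<^sub>R (mat 1 :: complex ^ 3 ^ 3)"
  define M where "M = (1 / 2) *\<^sub>R (?A - ?D)"
  have herm: "gell_mann n $ a $ b = cnj (gell_mann n $ b $ a)" for n a b
    using exhaust_3 [of a] exhaust_3 [of b] by (auto simp: gell_mann_def)
  have "trace M = 0"
    using gell_mann_trace [OF assms] gell_mann_trace [OF assms(2,1)]
    by (cases "j = k"; simp add: M_def trace_def sum_3 mat_def algebra_simps complex_eq_iff; linarith)
  moreover have "M $ a $ b = cnj (M $ b $ a)" for a b
  proof -
    have "(gell_mann n ** gell_mann m) $ a $ b = cnj ((gell_mann m ** gell_mann n) $ b $ a)" for n m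
      unfolding matrix_matrix_mult_def
      by (simp add: mult.commute herm [of n a] herm [of m _ b])
    then show ?thesis
      by (simp add: M_def mat_def add.commute)
  qed
  ultimately obtain f :: "nat \<Rightarrow> real" where f: "M = (\<Sum>m=1..8. f m *\<^sub>R gell_mann m)"
    using gell_mann_span by blast
  have A: "?A = ?D + 2 *\<^sub>R M" by (simp add: M_def)
  have "gell_mann_d j k l = f l" if "l \<in> {1..8}" for l
    unfolding gell_mann_d_def
  proof (rule the_equality)
    show "\<exists>g. ?A = ?D + 2 *\<^sub>R (\<Sum>m=1..8. g m *\<^sub>R gell_mann m) \<and> f l = g l"
      using A f by auto
  next
    fix c
    assume "\<exists>g. ?A = ?D + 2 *\<^sub>R (\<Sum>m=1..8. g m *\<^sub>R gell_mann m) \<and> c = g l"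
    then obtain g where "?A = ?D + 2 *\<^sub>R (\<Sum>m=1..8. g m *\<^sub>R gell_mann m)" "c = g l" by blast
    then have "(\<Sum>m=1..8. g m *\<^sub>R gell_mann m) = (\<Sum>m=1..8. f m *\<^sub>R gell_mann m)"
      using A f by simp
    then show "c = f l" using gell_mann_independent that \<open>c = g l\<close> by blast
  qed
  then have "M = (\<Sum>l=1..8. gell_mann_d j k l *\<^sub>R gell_mann l)"
    using f by simp
  with A show ?thesis by simp
qed

text \<open>The trace is real for Hermitian \<open>\<rho>\<close>, so that taking the real part loses nothing.\<close>

definition bloch :: "complex ^ 3 ^ 3 \<Rightarrow> nat \<Rightarrow> real" where
  "bloch \<rho> n = sqrt 3 / 2 * Re (trace (\<rho> ** gell_mann n))"

definition q3_point :: "(nat \<Rightarrow> real) \<Rightarrow> q3" where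
  "q3_point x = (1 / 3 + x 1) *\<^sub>R 1 + (\<Sum>n=2..8. x n *\<^sub>R eps ^ (n - 1))"

definition density_map :: "(complex ^ 3) set \<Rightarrow> q3" where
  "density_map L = q3_point (bloch (state_projector L))"

definition state_variety :: "q3 set" where
  "state_variety = {q3_point x | x.
     (\<Sum>n=1..8. (x n)\<^sup>2) = 1 \<and>
     (\<forall>l\<in>{1..8}. (\<Sum>j=1..8. \<Sum>k=1..8. gell_mann_d j k l * x j * x k) = 1 / sqrt 3 * x l)}"

end

theory Submission
  imports Defs
begin

text \<open>
  A point of the variety is a trace-one Hermitian matrix \<open>\<rho> = 1/3 + \<Sum> x\<^sub>n \<lambda>\<^sub>n / sqrt 3\<close>, and the relation for
  \<open>d\<^sub>j\<^sub>k\<^sub>l\<close> turns its defining equations into \<open>\<rho>\<^sup>2 = \<rho>\<close>, that is, into \<open>\<rho> = |\<psi>\<rangle>\<langle>\<psi>|\<close>.  So the density map is a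
  continuous bijection from a compact space onto the variety.  Since the trace form on traceless
  Hermitian matrices is \<open>2/3\<close> times the Euclidean inner product of the coefficients, differentiating
  \<open>|\<psi>\<rangle>\<langle>\<psi>|\<close> along unit vectors gives \<open>ds\<^sup>2 = 3/2 Tr(d\<rho> d\<rho>) = 3 ds\<^sup>2\<^sub>F\<^sub>S\<close>.

  All differential-geometric claims reduce to one observation: the affine charts of the projective
  plane and the slice charts of the variety are both charts of a set \<open>X\<close> that a map \<open>f\<close> into
  \<open>\<real>[\<epsilon>]/(\<epsilon>\<^sup>8)\<close> makes into a parametrised surface whose coordinates extend to smooth functions of the
  ambient space (with \<open>f\<close> the density map and the identity, respectively).
\<close>

section \<open>Calculus of smooth maps\<close>


text \<open>The variety is given by nine equations in eight unknowns but has dimension four, so the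
  differentials of these equations are dependent and do not yield charts directly. The ambient
  diffeomorphisms that \<open>submanifold_atlas\<close> demands are therefore built by hand: over
  the affine coordinates, the remaining entries of a matrix on the variety are explicit rational
  functions of their real and imaginary parts, and subtracting these functions straightens the
  variety. Conversely, that atlas contains every slice chart, so the smoothness and metric claims
  must hold for charts of which only the slice property is known; \<open>embedded_chart\<close>
  isolates what suffices. The definition of \<open>fubini_study\<close> by a description over local
  sections becomes tractable once it is identified with one third of the metric pulled back along
  the density map.\<close>

lemma Ck_on_cong:
  assumes "open S" "\<And>x. x \<in> S \<Longrightarrow> f x = g x" "Ck_on k S f"
  shows "Ck_on k S g"
  using assms(2,3)
proof (induction k arbitrary: f g)
  case 0
  then show ?case by (auto cong: continuous_on_cong)
next
  case (Suc k)
  have d: "(g has_derivative frechet_derivative f (at x)) (at x)" if "x \<in> S" for x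
    using Suc.prems that assms(1)
    by (metis Ck_on.simps(2) frechet_derivative_works has_derivative_transform_within_open)
  then have eq: "frechet_derivative g (at x) = frechet_derivative f (at x)" if "x \<in> S" for x
    using that by (metis frechet_derivative_at)
  have "Ck_on k S (\<lambda>x. frechet_derivative g (at x) v)" for v
    using Suc.IH[of "\<lambda>x. frechet_derivative f (at x) v" "\<lambda>x. frechet_derivative g (at x) v"]
      Suc.prems(2) eq by simp
  then show ?case using d by (auto simp: differentiable_def)
qed

lemma Ck_on_subset: "Ck_on k S f \<Longrightarrow> T \<subseteq> S \<Longrightarrow> Ck_on k T f"
  by (induction k arbitrary: f) (auto intro: continuous_on_subset)

lemma Ck_on_SucD: "Ck_on (Suc k) S f \<Longrightarrow> Ck_on k S f"
proof (induction k arbitrary: f)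
  case 0
  then show ?case
    by (auto simp: continuous_on_eq_continuous_at differentiable_imp_continuous_within
        intro!: continuous_at_imp_continuous_on)
qed auto

text \<open>\<open>Ck_on\<close> speaks of \<open>frechet_derivative\<close>. On an open set
  uniqueness of the derivative allows any explicit formula \<open>f'\<close> in its place.\<close>

lemma Ck_on_SucI:
  assumes "open S" "\<And>x. x \<in> S \<Longrightarrow> (f has_derivative f' x) (at x)"
    "\<And>v. Ck_on k S (\<lambda>x. f' x v)"
  shows "Ck_on (Suc k) S f"
proof -
  have "Ck_on k S (\<lambda>x. frechet_derivative f (at x) v)" for v
    by (rule Ck_on_cong[OF assms(1) _ assms(3)[of v]]) (metis assms(2) frechet_derivative_at)
  then show ?thesis using assms(2) by (auto simp: differentiable_def)
qed

lemma Ck_on_const: "Ck_on k S (\<lambda>_. c)"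
  by (induction k arbitrary: c) auto

lemma Ck_on_bounded_linear:
  assumes "bounded_linear f"
  shows "Ck_on k S f"
proof (cases k)
  case 0
  then show ?thesis using assms by (simp add: linear_continuous_on)
next
  case (Suc m)
  have "(f has_derivative f) (at x)" for x
    using assms by (rule bounded_linear_imp_has_derivative)
  then have "frechet_derivative f (at x) = f" "f differentiable (at x)" for x
    by (metis frechet_derivative_at) (use \<open>\<And>x. (f has_derivative f) (at x)\<close> in \<open>auto simp: differentiable_def\<close>)
  then show ?thesis by (simp add: Suc Ck_on_const)
qed

lemma Ck_on_add:
  assumes "open S"
  shows "Ck_on k S f \<Longrightarrow> Ck_on k S g \<Longrightarrow> Ck_on k S (\<lambda>x. f x + g x)"
proof (induction k arbitrary: f g)
  case 0
  then show ?case by (auto intro: continuous_intros)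
next
  case (Suc k)
  show ?case
  proof (rule Ck_on_SucI[OF assms])
    fix x assume "x \<in> S"
    then show "((\<lambda>x. f x + g x) has_derivative
        (\<lambda>v. frechet_derivative f (at x) v + frechet_derivative g (at x) v)) (at x)"
      using Suc.prems by (intro has_derivative_add) (auto simp: frechet_derivative_works)
  qed (use Suc in auto)
qed

lemma Ck_on_sum:
  assumes "open S" "\<And>i. i \<in> I \<Longrightarrow> Ck_on k S (f i)"
  shows "Ck_on k S (\<lambda>x. \<Sum>i\<in>I. f i x)"
  using assms(2)
  by (induction I rule: infinite_finite_induct) (auto intro: Ck_on_const Ck_on_add[OF assms(1)])

text \<open>The product rule gives a sum of two terms of the same bilinear shape, so the induction
  closes. One rule thus covers scalar multiples, inner products, algebra products and
  \<open>ket_bra\<close>.\<close>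

lemma Ck_on_bilinear:
  assumes "open S" "bounded_bilinear h"
  shows "Ck_on k S f \<Longrightarrow> Ck_on k S g \<Longrightarrow> Ck_on k S (\<lambda>x. h (f x) (g x))"
proof (induction k arbitrary: f g)
  case 0
  then show ?case using assms(2) by (auto intro: bounded_bilinear.continuous_on)
next
  case (Suc k)
  show ?case
  proof (rule Ck_on_SucI[OF assms(1)])
    fix x assume "x \<in> S"
    then show "((\<lambda>x. h (f x) (g x)) has_derivative
        (\<lambda>v. h (f x) (frechet_derivative g (at x) v) + h (frechet_derivative f (at x) v) (g x))) (at x)"
      using Suc.prems by (intro bounded_bilinear.FDERIV[OF assms(2)]) (auto simp: frechet_derivative_works)
  next
    fix v
    show "Ck_on k S (\<lambda>x. h (f x) (frechet_derivative g (at x) v) + h (frechet_derivative f (at x) v) (g x))"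
      using Suc Ck_on_SucD[OF Suc.prems(1)] Ck_on_SucD[OF Suc.prems(2)]
      by (intro Ck_on_add[OF assms(1)] Suc.IH) auto
  qed
qed

text \<open>In the chain rule the outer derivative is taken in a direction that varies with
  \<open>x\<close>, while \<open>Ck_on\<close> controls only fixed directions. Expanding the
  direction in \<open>Basis\<close> leaves fixed directions \<open>b\<close> with scalar
  coefficients, to which sums, products and the induction hypothesis apply.\<close>

lemma Ck_on_compose:
  fixes f :: "'a::real_normed_vector \<Rightarrow> 'b::euclidean_space" and g :: "'b \<Rightarrow> 'c::real_normed_vector"
  assumes "open S" "f ` S \<subseteq> T"
  shows "Ck_on k S f \<Longrightarrow> Ck_on k T g \<Longrightarrow> Ck_on k S (\<lambda>x. g (f x))"
proof (induction k arbitrary: g)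
  case 0
  then show ?case using assms(2) by (auto intro: continuous_on_compose2)
next
  case (Suc k)
  show ?case
  proof (rule Ck_on_SucI[OF assms(1)])
    fix x assume x: "x \<in> S"
    let ?f = "frechet_derivative f (at x)" and ?g = "frechet_derivative g (at (f x))"
    have f: "(f has_derivative ?f) (at x)" and g: "(g has_derivative ?g) (at (f x))"
      using x Suc.prems assms(2) by (auto simp: frechet_derivative_works image_subset_iff)
    have "?g (?f v) = (\<Sum>b\<in>Basis. (?f v \<bullet> b) *\<^sub>R ?g b)" for v
    proof -
      have "linear ?g" using g has_derivative_linear by blast
      then have "?g (\<Sum>b\<in>Basis. (?f v \<bullet> b) *\<^sub>R b) = (\<Sum>b\<in>Basis. (?f v \<bullet> b) *\<^sub>R ?g b)"
        by (simp add: linear_sum linear_scale)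
      then show ?thesis by (simp add: euclidean_representation)
    qed
    then show "((\<lambda>x. g (f x)) has_derivative (\<lambda>v. \<Sum>b\<in>Basis. (?f v \<bullet> b) *\<^sub>R ?g b)) (at x)"
      using has_derivative_compose[OF f g] by simp
  next
    fix v
    have 1: "Ck_on k S (\<lambda>x. frechet_derivative g (at (f x)) b)" for b
      using Suc.IH[of "\<lambda>y. frechet_derivative g (at y) b"] Suc.prems Ck_on_SucD[OF Suc.prems(1)] by simp
    have 2: "Ck_on k S (\<lambda>x. frechet_derivative f (at x) v \<bullet> b)" for b
      by (rule Ck_on_bilinear[OF assms(1) bounded_bilinear_inner _ Ck_on_const]) (use Suc.prems in auto)
    show "Ck_on k S (\<lambda>x. \<Sum>b\<in>Basis. (frechet_derivative f (at x) v \<bullet> b) *\<^sub>R frechet_derivative g (at (f x)) b)"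
      by (intro Ck_on_sum[OF assms(1)] Ck_on_bilinear[OF assms(1) bounded_bilinear_scaleR] 1 2)
  qed
qed

section \<open>Closure properties of maps of class C-infinity\<close>

lemma smooth_on_cong:
  "open S \<Longrightarrow> (\<And>x. x \<in> S \<Longrightarrow> f x = g x) \<Longrightarrow> smooth_on S f \<Longrightarrow> smooth_on S g"
  unfolding smooth_on_def using Ck_on_cong by blast

lemma smooth_on_subset: "smooth_on S f \<Longrightarrow> T \<subseteq> S \<Longrightarrow> smooth_on T f"
  unfolding smooth_on_def using Ck_on_subset by blast

lemma smooth_on_continuous: "smooth_on S f \<Longrightarrow> continuous_on S f"
  unfolding smooth_on_def by (metis Ck_on.simps(1))

lemma smooth_on_has_derivative:
  assumes "smooth_on S f" "x \<in> S"
  shows "(f has_derivative frechet_derivative f (at x)) (at x)"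
proof -
  have "Ck_on (Suc 0) S f" using assms(1) unfolding smooth_on_def by blast
  then show ?thesis using assms(2) by (simp add: frechet_derivative_works)
qed

lemma smooth_on_frechet_derivative:
  "smooth_on S f \<Longrightarrow> smooth_on S (\<lambda>x. frechet_derivative f (at x) v)"
  unfolding smooth_on_def by (metis Ck_on.simps(2))

lemma smooth_on_const: "smooth_on S (\<lambda>_. c)"
  by (simp add: smooth_on_def Ck_on_const)

lemma smooth_on_linear:
  fixes f :: "'a::euclidean_space \<Rightarrow> 'b::real_normed_vector"
  shows "linear f \<Longrightarrow> smooth_on S f"
  by (simp add: smooth_on_def Ck_on_bounded_linear linear_conv_bounded_linear)

lemma smooth_on_add:
  "open S \<Longrightarrow> smooth_on S f \<Longrightarrow> smooth_on S g \<Longrightarrow> smooth_on S (\<lambda>x. f x + g x)"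
  by (simp add: smooth_on_def Ck_on_add)

lemma smooth_on_sum:
  "open S \<Longrightarrow> (\<And>i. i \<in> I \<Longrightarrow> smooth_on S (f i)) \<Longrightarrow> smooth_on S (\<lambda>x. \<Sum>i\<in>I. f i x)"
  by (simp add: smooth_on_def Ck_on_sum)

lemma smooth_on_bilinear:
  "open S \<Longrightarrow> bounded_bilinear h \<Longrightarrow> smooth_on S f \<Longrightarrow> smooth_on S g \<Longrightarrow>
    smooth_on S (\<lambda>x. h (f x) (g x))"
  by (simp add: smooth_on_def Ck_on_bilinear)

lemma smooth_on_compose:
  fixes f :: "'a::real_normed_vector \<Rightarrow> 'b::euclidean_space" and g :: "'b \<Rightarrow> 'c::real_normed_vector"
  shows "open S \<Longrightarrow> smooth_on T g \<Longrightarrow> smooth_on S f \<Longrightarrow> f ` S \<subseteq> T \<Longrightarrow> smooth_on S (\<lambda>x. g (f x))"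
  unfolding smooth_on_def using Ck_on_compose by blast

lemma smooth_on_linear_compose:
  fixes f :: "'a::real_normed_vector \<Rightarrow> 'b::euclidean_space" and g :: "'b \<Rightarrow> 'c::real_normed_vector"
  shows "open S \<Longrightarrow> linear g \<Longrightarrow> smooth_on S f \<Longrightarrow> smooth_on S (\<lambda>x. g (f x))"
  using smooth_on_compose[OF _ smooth_on_linear[of g UNIV]] by blast

lemmas smooth_on_scaleR = smooth_on_bilinear[OF _ bounded_bilinear_scaleR]
lemmas smooth_on_inner = smooth_on_bilinear[OF _ bounded_bilinear_inner]

lemma smooth_on_mult:
  fixes f g :: "'a::real_normed_vector \<Rightarrow> 'b::real_normed_algebra"
  shows "open S \<Longrightarrow> smooth_on S f \<Longrightarrow> smooth_on S g \<Longrightarrow> smooth_on S (\<lambda>x. f x * g x)"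
  by (rule smooth_on_bilinear[OF _ bounded_bilinear_mult])

lemma smooth_on_minus:
  assumes "open S" "smooth_on S f" 
  shows "smooth_on S (\<lambda>x. - f x)"
  using smooth_on_scaleR[OF assms(1) smooth_on_const[of S "-1"] assms(2)] by simp

lemma smooth_on_diff:
  assumes "open S" "smooth_on S f" "smooth_on S g"
  shows "smooth_on S (\<lambda>x. f x - g x)"
  using smooth_on_add[OF assms(1,2) smooth_on_minus[OF assms(1,3)]] by simp

lemma smooth_on_vec:
  fixes f :: "'a::real_normed_vector \<Rightarrow> 'b::euclidean_space ^ 'n"
  assumes "open S" "\<And>i. smooth_on S (\<lambda>x. f x $ i)"
  shows "smooth_on S f"
proof -
  have "linear (axis i :: 'b \<Rightarrow> 'b ^ 'n)" for i
    by (rule linearI) (auto simp: axis_def vec_eq_iff)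
  then have "smooth_on S (\<lambda>x. \<Sum>i\<in>UNIV. axis i (f x $ i))"
    using assms by (intro smooth_on_sum) (auto intro: smooth_on_linear_compose)
  moreover have "(\<Sum>i\<in>UNIV. axis i (f x $ i)) = f x" for x
    by (simp add: vec_eq_iff axis_def if_distrib cong: if_cong)
  ultimately show ?thesis by simp
qed

lemma smooth_on_nth:
  fixes f :: "'a::real_normed_vector \<Rightarrow> 'b::euclidean_space ^ 'n"
  shows "open S \<Longrightarrow> smooth_on S f \<Longrightarrow> smooth_on S (\<lambda>x. f x $ i)"
  by (rule smooth_on_linear_compose) (auto intro: linearI)

lemma smooth_on_powr_real: "smooth_on {0<..} (\<lambda>x::real. x powr a)"
proof -
  \<comment> \<open>The induction needs a family closed under differentiation, hence the free factor
    \<open>c\<close> and the free exponent.\<close>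
  have "Ck_on k {0<..} (\<lambda>x::real. c * x powr a)" for k c
  proof (induction k arbitrary: a c)
    case 0
    show ?case by (auto intro!: continuous_intros)
  next
    case (Suc k)
    show ?case
    proof (rule Ck_on_SucI)
      fix x :: real assume "x \<in> {0<..}"
      then show "((\<lambda>x. c * x powr a) has_derivative (\<lambda>v. (v * c * a) * x powr (a - 1))) (at x)"
        by (auto intro!: derivative_eq_intros simp: fun_eq_iff field_simps powr_diff)
    qed (use Suc in auto)
  qed
  from this[of _ 1] show ?thesis by (simp add: smooth_on_def)
qed

lemma smooth_on_powr:
  fixes f :: "'a::real_normed_vector \<Rightarrow> real"
  shows "open S \<Longrightarrow> smooth_on S f \<Longrightarrow> (\<And>x. x \<in> S \<Longrightarrow> 0 < f x) \<Longrightarrow> smooth_on S (\<lambda>x. f x powr a)"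
  by (rule smooth_on_compose[OF _ smooth_on_powr_real]) auto

lemma smooth_on_inverse:
  fixes f :: "'a::real_normed_vector \<Rightarrow> real"
  assumes "open S" "smooth_on S f" "\<And>x. x \<in> S \<Longrightarrow> 0 < f x"
  shows "smooth_on S (\<lambda>x. inverse (f x))"
  by (rule smooth_on_cong[OF assms(1) _ smooth_on_powr[OF assms, of "-1"]])
    (use assms(3) in \<open>auto simp: powr_minus order_less_imp_le\<close>)


section \<open>Charts parametrising subsets of a Euclidean space\<close>

text \<open>
  The ambient function \<open>\<Phi>\<close> recovers the coordinates from \<open>f\<close>.  It makes transition maps smooth (they
  are \<open>\<Phi> \<circ> f \<circ> \<phi>\<^sup>-\<^sup>1\<close>) and the derivative of the parametrisation injective, without any appeal to the
  inverse function theorem.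
\<close>

definition embedded_chart ::
  "('a \<Rightarrow> 'v::euclidean_space) \<Rightarrow> 'a set \<Rightarrow> ('a, 'e::euclidean_space) chart \<Rightarrow> bool" where
  "embedded_chart f X c \<longleftrightarrow>
     open (snd c ` fst c) \<and> inj_on (snd c) (fst c) \<and>
     smooth_on (snd c ` fst c) (f \<circ> inv_into (fst c) (snd c)) \<and>
     (\<exists>W \<Phi>. open W \<and> smooth_on W \<Phi> \<and> fst c = {p \<in> X. f p \<in> W} \<and> (\<forall>p\<in>fst c. \<Phi> (f p) = snd c p))"

text \<open>The differential of \<open>f\<close> at \<open>p\<close> read in the chart
  \<open>c\<close>. Its values lie in the ambient space, where tangent vectors coming from different
  charts can be compared.\<close>

definition param_deriv :: "('a \<Rightarrow> 'v::euclidean_space) \<Rightarrow> ('a, 'e::euclidean_space) chart \<Rightarrow> 'a \<Rightarrow> 'e \<Rightarrow> 'v" where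
  "param_deriv f c p = frechet_derivative (f \<circ> inv_into (fst c) (snd c)) (at (snd c p))"

text \<open>One definition serves both metrics: \<open>k = 1\<close> gives the induced metric,
  \<open>k = 1 / 3\<close> the Fubini-Study metric.\<close>

definition pullback_metric :: "real \<Rightarrow> ('a \<Rightarrow> 'v::euclidean_space) \<Rightarrow> ('a, 'e::euclidean_space) metric" where
  "pullback_metric k f c p u v = k * inner (param_deriv f c p u) (param_deriv f c p v)"

lemma induced_metric_eq_pullback: "induced_metric = pullback_metric 1 id"
  by (simp add: fun_eq_iff induced_metric_def pullback_metric_def param_deriv_def)

lemma
  assumes "embedded_chart f X c"
  shows embedded_chart_open: "open (snd c ` fst c)"
    and embedded_chart_smooth: "smooth_on (snd c ` fst c) (f \<circ> inv_into (fst c) (snd c))"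
    and embedded_chart_subset: "fst c \<subseteq> X"
  using assms by (auto simp: embedded_chart_def)

lemma embedded_chart_inv:
  assumes "embedded_chart f X c" "p \<in> fst c"
  shows "inv_into (fst c) (snd c) (snd c p) = p"
  using assms by (metis embedded_chart_def inv_into_f_f)

lemma param_deriv_has_derivative:
  assumes "embedded_chart f X c" "p \<in> fst c"
  shows "((f \<circ> inv_into (fst c) (snd c)) has_derivative param_deriv f c p) (at (snd c p))"
  unfolding param_deriv_def
  by (rule smooth_on_has_derivative[OF embedded_chart_smooth[OF assms(1)]]) (use assms(2) in auto)

lemma inj_param_deriv:
  assumes c: "embedded_chart f X c" and p: "p \<in> fst c"
  shows "inj (param_deriv f c p)"
proof -
  obtain W \<Phi> where W: "open W" "smooth_on W \<Phi>" "fst c = {p \<in> X. f p \<in> W}" "\<And>p. p \<in> fst c \<Longrightarrow> \<Phi> (f p) = snd c p"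
    using c unfolding embedded_chart_def by blast
  let ?h = "f \<circ> inv_into (fst c) (snd c)"
  have "?h (snd c p) = f p" using embedded_chart_inv[OF c p] by simp
  then have "(\<Phi> has_derivative frechet_derivative \<Phi> (at (f p))) (at (?h (snd c p)))"
    using smooth_on_has_derivative[OF W(2)] W(3) p by auto
  \<comment> \<open>Since \<open>\<Phi>\<close> undoes the parametrisation, its derivative is a left
    inverse of \<open>param_deriv\<close>.\<close>
  from has_derivative_compose[OF param_deriv_has_derivative[OF c p] this]
  have 1: "((\<lambda>y. \<Phi> (?h y)) has_derivative (\<lambda>v. frechet_derivative \<Phi> (at (f p)) (param_deriv f c p v))) (at (snd c p))" .
  have "\<Phi> (?h y) = y" if "y \<in> snd c ` fst c" for y
    using that W(4) embedded_chart_inv[OF c] by auto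
  then have "((\<lambda>y. y) has_derivative (\<lambda>v. frechet_derivative \<Phi> (at (f p)) (param_deriv f c p v))) (at (snd c p))"
    using has_derivative_transform_within_open[OF 1, of "snd c ` fst c"] embedded_chart_open[OF c] p
    by simp
  then have "(\<lambda>v. frechet_derivative \<Phi> (at (f p)) (param_deriv f c p v)) = (\<lambda>v. v)"
    using has_derivative_unique has_derivative_ident by blast
  then show ?thesis by (metis injI)
qed

text \<open>The condition on \<open>h\<close> says that it becomes the identity in the ambient
  space. This covers changes of chart (\<open>h = id\<close>), the density map and its inverse at
  once. The domain is open because the chart domain of \<open>d\<close> is cut out of
  \<open>Y\<close> by an ambient open set.\<close>

lemma
  fixes f :: "'a \<Rightarrow> 'v::euclidean_space"
    and c :: "('a, 'e::euclidean_space) chart" and d :: "('b, 'd::euclidean_space) chart"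
  assumes c: "embedded_chart f X c" and d: "embedded_chart g Y d"
    and h: "\<And>p. p \<in> X \<Longrightarrow> h p \<in> Y \<and> g (h p) = f p"
  shows embedded_chart_transition_open: "open (snd c ` (fst c \<inter> h -` fst d))"
    and embedded_chart_transition_smooth:
      "smooth_on (snd c ` (fst c \<inter> h -` fst d)) (snd d \<circ> h \<circ> inv_into (fst c) (snd c))"
proof -
  obtain W \<Phi> where W: "open W" "smooth_on W \<Phi>" "fst d = {p \<in> Y. g p \<in> W}" "\<And>p. p \<in> fst d \<Longrightarrow> \<Phi> (g p) = snd d p"
    using d unfolding embedded_chart_def by blast
  let ?h = "f \<circ> inv_into (fst c) (snd c)"
  have X: "fst c \<subseteq> X" using c by (rule embedded_chart_subset)
  let ?D = "snd c ` (fst c \<inter> h -` fst d)"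
  have D: "?D = snd c ` fst c \<inter> ?h -` W"
    using embedded_chart_inv[OF c] X h unfolding W(3) by (auto 0 3 simp: subset_iff)
  show o: "open ?D"
    unfolding D by (rule continuous_open_preimage
      [OF smooth_on_continuous[OF embedded_chart_smooth[OF c]] embedded_chart_open[OF c] W(1)])
  have s: "smooth_on ?D ?h"
    by (rule smooth_on_subset[OF embedded_chart_smooth[OF c]]) auto
  have "smooth_on ?D (\<lambda>x. \<Phi> (?h x))"
    by (rule smooth_on_compose[OF o W(2) s]) (unfold D, auto)
  then show "smooth_on ?D (snd d \<circ> h \<circ> inv_into (fst c) (snd c))"
  proof (rule smooth_on_cong[OF o, rotated])
    fix y assume "y \<in> ?D"
    then obtain p where p: "y = snd c p" "p \<in> fst c" "h p \<in> fst d" by auto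
    then have "\<Phi> (f p) = snd d (h p)" using W(4)[of "h p"] h[of p] X by auto
    then show "\<Phi> (?h y) = (snd d \<circ> h \<circ> inv_into (fst c) (snd c)) y"
      using p embedded_chart_inv[OF c] by simp
  qed
qed

text \<open>The chain rule for \<open>g \<circ> h = f\<close>. From it follow the transformation law
  of the metric, the immersion property and the conformal relation, since each compares
  \<open>chart_deriv\<close> with ambient tangent vectors.\<close>

lemma param_deriv_chart_deriv:
  fixes f :: "'a \<Rightarrow> 'v::euclidean_space"
    and c :: "('a, 'e::euclidean_space) chart" and d :: "('b, 'd::euclidean_space) chart"
  assumes c: "embedded_chart f X c" and d: "embedded_chart g Y d"
    and h: "\<And>p. p \<in> X \<Longrightarrow> h p \<in> Y \<and> g (h p) = f p"
    and p: "p \<in> fst c" "h p \<in> fst d"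
  shows "param_deriv g d (h p) (chart_deriv c d h p v) = param_deriv f c p v"
proof -
  let ?t = "snd d \<circ> h \<circ> inv_into (fst c) (snd c)"
  let ?D = "snd c ` (fst c \<inter> h -` fst d)"
  have D: "snd c p \<in> ?D" using p by auto
  have "(?t has_derivative chart_deriv c d h p) (at (snd c p))"
    unfolding chart_deriv_def
    by (rule smooth_on_has_derivative[OF embedded_chart_transition_smooth[OF c d h] D])
  moreover have "((g \<circ> inv_into (fst d) (snd d)) has_derivative param_deriv g d (h p)) (at (?t (snd c p)))"
    using param_deriv_has_derivative[OF d p(2)] embedded_chart_inv[OF c p(1)] by simp
  ultimately have "((\<lambda>y. (g \<circ> inv_into (fst d) (snd d)) (?t y)) has_derivative
      (\<lambda>v. param_deriv g d (h p) (chart_deriv c d h p v))) (at (snd c p))"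
    by (rule has_derivative_compose)
  then have "((f \<circ> inv_into (fst c) (snd c)) has_derivative
      (\<lambda>v. param_deriv g d (h p) (chart_deriv c d h p v))) (at (snd c p))"
  proof (rule has_derivative_transform_within_open[OF _ embedded_chart_transition_open[OF c d h] D])
    fix y assume "y \<in> ?D"
    then obtain q where q: "y = snd c q" "q \<in> fst c" "h q \<in> fst d" by auto
    have "q \<in> X" using q(2) embedded_chart_subset[OF c] by blast
    then show "(g \<circ> inv_into (fst d) (snd d)) (?t y) = (f \<circ> inv_into (fst c) (snd c)) y"
      using q embedded_chart_inv[OF c] embedded_chart_inv[OF d] h by simp
  qed
  with param_deriv_has_derivative[OF c p(1)] show ?thesis
    using has_derivative_unique by metis
qed

text \<open>Definiteness comes from injectivity of \<open>param_deriv\<close>, the transformation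
  law from the chain rule with \<open>h = id\<close>.\<close>

lemma riemannian_metric_pullback:
  fixes A :: "('a, 'e::euclidean_space) chart set"
  assumes A: "\<And>c. c \<in> A \<Longrightarrow> embedded_chart f X c" and "k > 0"
  shows "riemannian_metric A (pullback_metric k f)"
  unfolding riemannian_metric_def
proof (intro conjI ballI allI)
  fix c p assume c: "c \<in> A" "p \<in> fst c"
  have lin: "linear (param_deriv f c p)"
    using param_deriv_has_derivative[OF A[OF c(1)] c(2)] has_derivative_linear by blast
  show "bilinear (pullback_metric k f c p)"
    unfolding bilinear_def pullback_metric_def
    by (auto intro!: linearI simp: linear_add[OF lin] linear_scale[OF lin] inner_add algebra_simps)
  show "pullback_metric k f c p u v = pullback_metric k f c p v u" for u v
    by (simp add: pullback_metric_def inner_commute)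
  show "u \<noteq> 0 \<longrightarrow> 0 < pullback_metric k f c p u u" for u
    using inj_param_deriv[OF A[OF c(1)] c(2)] \<open>k > 0\<close>
    unfolding pullback_metric_def linear_injective_0[OF lin]
    by (metis inner_gt_zero_iff mult_pos_pos)
next
  have "smooth_on (snd c ` fst c) (\<lambda>y. pullback_metric k f c (inv_into (fst c) (snd c) y) u v)"
    if "c \<in> A" for c u v
  proof -
    let ?h = "f \<circ> inv_into (fst c) (snd c)"
    note o = embedded_chart_open[OF A[OF that]] and s = embedded_chart_smooth[OF A[OF that]]
    have "smooth_on (snd c ` fst c) (\<lambda>y. k * inner (frechet_derivative ?h (at y) u) (frechet_derivative ?h (at y) v))"
      by (intro smooth_on_mult smooth_on_inner smooth_on_const smooth_on_frechet_derivative o s)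
    then show ?thesis
      by (rule smooth_on_cong[OF o, rotated])
        (auto simp: pullback_metric_def param_deriv_def embedded_chart_inv[OF A[OF that]])
  qed
  then show "case x of (U, \<phi>) \<Rightarrow> \<forall>u v. smooth_on (\<phi> ` U) (\<lambda>y. pullback_metric k f (U, \<phi>) (inv_into U \<phi> y) u v)"
    if "x \<in> A" for x using that by (auto split: prod.split)
next
  fix c d p u v assume "c \<in> A" "d \<in> A" "p \<in> fst c \<inter> fst d"
  then show "pullback_metric k f d p (chart_deriv c d id p u) (chart_deriv c d id p v) = pullback_metric k f c p u v"
    using param_deriv_chart_deriv[of f X c f X d id p] A by (simp add: pullback_metric_def)
qed

lemma conformal_pullback:
  assumes A: "\<And>c. c \<in> A \<Longrightarrow> embedded_chart f X c" and B: "\<And>d. d \<in> B \<Longrightarrow> embedded_chart g Y d"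
    and h: "\<And>p. p \<in> X \<Longrightarrow> h p \<in> Y \<and> g (h p) = f p"
  shows "conformal_with_factor k A (pullback_metric a f) B (pullback_metric (k * a) g) h"
  unfolding conformal_with_factor_def pullback_metric_def
  using param_deriv_chart_deriv[OF A B h] by auto

text \<open>If a composite is injective, then so is the map applied first; here the composite is
  \<open>param_deriv f c p\<close>.\<close>

lemma immersion_embedded:
  assumes A: "\<And>c. c \<in> A \<Longrightarrow> embedded_chart f X c" and B: "\<And>d. d \<in> B \<Longrightarrow> embedded_chart g Y d"
    and h: "\<And>p. p \<in> X \<Longrightarrow> h p \<in> Y \<and> g (h p) = f p"
  shows "immersion A B h"
  unfolding immersion_def
proof (intro ballI allI impI)
  fix c d p assume *: "c \<in> A" "d \<in> B" "p \<in> fst c \<and> h p \<in> fst d"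
  then have "param_deriv g d (h p) (chart_deriv c d h p v) = param_deriv f c p v" for v
    using param_deriv_chart_deriv[OF A B h] by blast
  then show "inj (chart_deriv c d h p)"
    using inj_param_deriv[OF A[OF *(1)]] *(3) by (metis injD injI)
qed

lemma smooth_map_embedded:
  assumes A: "\<And>c. c \<in> A \<Longrightarrow> embedded_chart f X c" and B: "\<And>d. d \<in> B \<Longrightarrow> embedded_chart g Y d"
    and h: "\<And>p. p \<in> X \<Longrightarrow> h p \<in> Y \<and> g (h p) = f p" and "continuous_map T U h"
  shows "smooth_map T A U B h"
  unfolding smooth_map_def
  using assms(4) embedded_chart_transition_smooth[OF A B h] by fastforce

text \<open>A chart is continuous because it is \<open>\<Phi> \<circ> f\<close>. Its inverse is
  continuous because its composite with \<open>f\<close> is the smooth parametrisation and the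
  embedding \<open>f\<close> has a continuous inverse on its image.\<close>

lemma smooth_atlas_embedded:
  assumes A: "\<And>c. c \<in> A \<Longrightarrow> embedded_chart f X c" and X: "topspace T = X"
    and f: "embedding_map T euclidean f" and cover: "(\<Union>c\<in>A. fst c) = X"
  shows "smooth_atlas T A"
  unfolding smooth_atlas_def
proof (intro conjI)
  show "(\<Union>(U, \<phi>)\<in>A. U) = topspace T" using cover X by (auto simp: split_def)
  have cf: "continuous_map T euclidean f" using f embedding_map_def homeomorphic_imp_continuous_map continuous_map_into_fulltopology by metis
  have "openin T (fst c) \<and> open (snd c ` fst c) \<and>
      homeomorphic_map (subtopology T (fst c)) (top_of_set (snd c ` fst c)) (snd c)" if cA: "c \<in> A" for c
  proof (intro conjI)
    obtain W \<Phi> where W: "open W" "smooth_on W \<Phi>" "fst c = {p \<in> X. f p \<in> W}" "\<And>p. p \<in> fst c \<Longrightarrow> \<Phi> (f p) = snd c p"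
      using A[OF cA] unfolding embedded_chart_def by blast
    show "openin T (fst c)"
      using openin_continuous_map_preimage[OF cf, of W] W X by simp
    show "open (snd c ` fst c)" using A[OF cA] by (rule embedded_chart_open)
    have ts: "topspace (subtopology T (fst c)) = fst c" using W(3) X by auto
    have sub: "fst c \<subseteq> X" using W(3) by auto
    let ?i = "inv_into (fst c) (snd c)"
    have "continuous_map (subtopology T (fst c)) (top_of_set W) f"
      using cf W(3) X by (auto simp: continuous_map_in_subtopology continuous_map_from_subtopology)
    then have "continuous_map (subtopology T (fst c)) euclidean (\<Phi> \<circ> f)"
      using smooth_on_continuous[OF W(2)] by (intro continuous_map_compose) auto
    then have 1: "continuous_map (subtopology T (fst c)) (top_of_set (snd c ` fst c)) (snd c)"
      by (auto simp: continuous_map_in_subtopology ts intro!: continuous_map_eq[of _ _ "\<Phi> \<circ> f"] W(4))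
    have "continuous_map (top_of_set (snd c ` fst c)) (top_of_set (f ` topspace T)) (f \<circ> ?i)"
      using smooth_on_continuous[OF embedded_chart_smooth[OF A[OF cA]]] X
        embedded_chart_subset[OF A[OF cA]] embedded_chart_inv[OF A[OF cA]]
      by (auto simp: continuous_map_in_subtopology)
    moreover obtain f' where f': "homeomorphic_maps T (top_of_set (f ` topspace T)) f f'"
      using f unfolding embedding_map_def homeomorphic_map_maps by (metis)
    ultimately have "continuous_map (top_of_set (snd c ` fst c)) T (f' \<circ> (f \<circ> ?i))"
      unfolding homeomorphic_maps_def using continuous_map_compose by blast
    moreover have "(f' \<circ> (f \<circ> ?i)) y = ?i y" if "y \<in> snd c ` fst c" for y
      using f' that X sub inv_into_into[of y "snd c" "fst c"]
      by (auto simp: homeomorphic_maps_def)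
    ultimately have "continuous_map (top_of_set (snd c ` fst c)) T ?i"
      by (rule continuous_map_eq) auto
    then have 2: "continuous_map (top_of_set (snd c ` fst c)) (subtopology T (fst c)) ?i"
      by (auto simp: continuous_map_in_subtopology intro: inv_into_into)
    have "homeomorphic_maps (subtopology T (fst c)) (top_of_set (snd c ` fst c)) (snd c) ?i"
      unfolding homeomorphic_maps_def using 1 2 ts embedded_chart_inv[OF A[OF cA]] by (auto simp: f_inv_into_f)
    then show "homeomorphic_map (subtopology T (fst c)) (top_of_set (snd c ` fst c)) (snd c)"
      using homeomorphic_map_maps by blast
  qed
  then show "\<forall>(U, \<phi>)\<in>A. openin T U \<and> open (\<phi> ` U) \<and> homeomorphic_map (subtopology T U) (top_of_set (\<phi> ` U)) \<phi>"
    by (auto simp: split_def)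
  have "smooth_on (snd c ` (fst c \<inter> fst d)) (snd d \<circ> inv_into (fst c) (snd c))" if "c \<in> A" "d \<in> A" for c d
    using embedded_chart_transition_smooth[OF A[OF that(1)] A[OF that(2)], of id] by simp
  then show "\<forall>(U, \<phi>)\<in>A. \<forall>(W, \<psi>)\<in>A. smooth_on (\<phi> ` (U \<inter> W)) (\<psi> \<circ> inv_into U \<phi>)"
    by (auto simp: split_def)
qed

lemma embedded_chart_euclidean: "c \<in> euclidean_atlas \<Longrightarrow> embedded_chart id UNIV c"
  by (auto simp: euclidean_atlas_def embedded_chart_def inv_id smooth_on_linear linear_id intro!: exI[of _ UNIV] exI[of _ id])

text \<open>The ambient coordinate function is \<open>L \<circ> F\<close>, and the parametrisation
  is \<open>G \<circ> M\<close> with \<open>M\<close> a linear inverse of \<open>L\<close> on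
  \<open>T\<close>. Only the slice property enters, so the result applies to the whole
  atlas.\<close>

lemma embedded_chart_submanifold:
  fixes c :: "('v::euclidean_space, 'e::euclidean_space) chart"
  assumes "c \<in> submanifold_atlas S"
  shows "embedded_chart id S c"
proof -
  obtain W W' F G T L where *: "open W" "open W'" "fst c = S \<inter> W"
     "F ` W = W'" "G ` W' = W" "\<forall>x\<in>W. G (F x) = x" "\<forall>y\<in>W'. F (G y) = y"
     "smooth_on W F" "smooth_on W' G"
     "subspace T" "F ` fst c = T \<inter> W'"
     "linear (L :: 'v \<Rightarrow> 'e)" "bij_betw L T UNIV" "\<forall>x\<in>fst c. snd c x = L (F x)"
    using assms unfolding submanifold_atlas_def mem_Collect_eq split_beta by (elim exE conjE) (rule that)
  \<comment> \<open>\<open>L\<close> is invertible only as a map from \<open>T\<close>;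
    \<open>M\<close> must take values in \<open>T\<close> for \<open>G \<circ> M\<close> to land on
    the slice.\<close>
  obtain M where M: "linear M" "M ` UNIV \<subseteq> T" "\<And>x. x \<in> T \<Longrightarrow> M (L x) = x"
    using linear_exists_left_inverse_on[OF *(12,10)] *(13) unfolding bij_betw_def by blast
  have LM: "L (M y) = y" for y using *(13) M(3) bij_betw_imp_surj_on by (metis UNIV_I imageE)
  have im: "snd c ` fst c = M -` W'"
  proof -
    have "snd c ` fst c = L ` F ` fst c" using *(14) by force
    also have "\<dots> = M -` W'" unfolding *(11)
    proof (intro equalityI subsetI)
      fix y assume "y \<in> L ` (T \<inter> W')"
      then show "y \<in> M -` W'" using M(3) by auto
    next
      fix y assume "y \<in> M -` W'"
      then show "y \<in> L ` (T \<inter> W')" using M(2) LM[of y] by (intro image_eqI[of _ _ "M y"]) auto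
    qed
    finally show ?thesis .
  qed
  have inv: "inv_into (fst c) (snd c) y = G (M y)" if "M y \<in> W'" for y
  proof (rule inv_into_f_eq)
    show inj: "inj_on (snd c) (fst c)"
      using *(3,6,11,14) by (intro inj_onI) (metis IntD1 IntD2 M(3) imageI)
    have "M y \<in> F ` fst c" using that M(2) *(11) by auto
    then obtain x where x: "x \<in> fst c" "F x = M y" by auto
    then have "G (M y) = x" using *(3,6) by (metis IntD2)
    then show "G (M y) \<in> fst c" "snd c (G (M y)) = y" using x *(14) LM by auto
  qed
  have op: "open (M -` W')"
    using *(2) M(1) by (simp add: linear_continuous_on linear_conv_bounded_linear open_vimage)
  show ?thesis
    unfolding embedded_chart_def
  proof (intro conjI exI[of _ W] exI[of _ "\<lambda>x. L (F x)"])
    show "open (snd c ` fst c)" using op im by simp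
    show "inj_on (snd c) (fst c)"
      using *(3,6,11,14) by (intro inj_onI) (metis IntD1 IntD2 M(3) imageI)
    have "smooth_on (M -` W') (\<lambda>y. G (M y))"
      by (rule smooth_on_compose[OF op *(9) smooth_on_linear[OF M(1)]]) auto
    then show "smooth_on (snd c ` fst c) (id \<circ> inv_into (fst c) (snd c))"
      unfolding im by (rule smooth_on_cong[OF op, rotated]) (simp add: inv)
    show "smooth_on W (\<lambda>x. L (F x))" using smooth_on_linear_compose[OF *(1,12,8)] .
  qed (use * in auto)
qed


section \<open>Hermitian matrices and their Bloch coordinates\<close>

lemma q3_coeff_sum [simp]: "q3_coeff (\<Sum>i\<in>I. f i) n = (\<Sum>i\<in>I. q3_coeff (f i) n)"
  by (induction I rule: infinite_finite_induct) auto

definition hermitian :: "complex ^ 'n ^ 'n \<Rightarrow> bool" where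
  "hermitian A \<longleftrightarrow> (\<forall>i j. cnj (A $ i $ j) = A $ j $ i)"

text \<open>
  \<open>bloch_vec\<close> and \<open>bloch_mat\<close> are inverse to each other on traceless Hermitian matrices; \<open>to_q3\<close> and \<open>of_q3\<close>
  are their affine versions for matrices of trace one, with \<open>origin\<close> the image of \<open>1/3\<close> times the unit matrix.
\<close>

definition bloch_vec :: "complex ^ 3 ^ 3 \<Rightarrow> q3" where
  "bloch_vec A = (\<Sum>n=1..8. bloch A n *\<^sub>R eps ^ (n - 1))"

definition bloch_mat :: "q3 \<Rightarrow> complex ^ 3 ^ 3" where
  "bloch_mat y = (1 / sqrt 3) *\<^sub>R (\<Sum>n=1..8. q3_coeff y (n - 1) *\<^sub>R gell_mann n)"

definition origin :: q3 where "origin = (1 / 3) *\<^sub>R 1"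

definition to_q3 :: "complex ^ 3 ^ 3 \<Rightarrow> q3" where
  "to_q3 A = origin + bloch_vec A"

definition of_q3 :: "q3 \<Rightarrow> complex ^ 3 ^ 3" where
  "of_q3 y = (1 / 3) *\<^sub>R mat 1 + bloch_mat (y - origin)"

lemma q3_point_eq: "q3_point x = origin + (\<Sum>n=1..8. x n *\<^sub>R eps ^ (n - 1))"
proof -
  have "{1..8::nat} = insert 1 {2..8}" by auto
  then show ?thesis by (simp add: q3_point_def origin_def scaleR_left_distrib)
qed

lemma to_q3_eq: "to_q3 A = q3_point (bloch A)"
  by (simp add: q3_point_eq to_q3_def bloch_vec_def)

text \<open>Matrices are numbered from 1 and powers of \<open>eps\<close> from 0, hence
  \<open>n - 1\<close>; on \<open>{1..8}\<close> the truncated subtraction is injective.\<close>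

lemma q3_coeff_eps_sum:
  assumes "n \<in> {1..8}"
  shows "q3_coeff (\<Sum>m=1..8. x m *\<^sub>R eps ^ (m - 1)) (n - 1) = x n"
proof -
  have "q3_coeff (\<Sum>m=1..8. x m *\<^sub>R eps ^ (m - 1)) (n - 1) = (\<Sum>m=1..8. x m * q3_coeff (eps ^ (m - 1)) (n - 1))"
    by simp
  also have "\<dots> = (\<Sum>m=1..8. if m = n then x m else 0)"
    using assms by (intro sum.cong) (auto simp: q3_coeff_eps_power split: if_splits)
  finally have "q3_coeff (\<Sum>m=1..8. x m *\<^sub>R eps ^ (m - 1)) (n - 1) = (\<Sum>m=1..8. if m = n then x m else 0)" .
  then show ?thesis using assms by simp
qed

lemma q3_eq_eps_sum: "(\<Sum>m=1..8. q3_coeff y (m - 1) *\<^sub>R eps ^ (m - 1)) = y"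
proof (rule q3_eqI)
  fix n :: nat assume "n < 8"
  then show "q3_coeff (\<Sum>m=1..8. q3_coeff y (m - 1) *\<^sub>R eps ^ (m - 1)) n = q3_coeff y n"
    using q3_coeff_eps_sum[of "Suc n" "\<lambda>m. q3_coeff y (m - 1)"] by simp
qed

lemma linear_q3_coeff: "linear (\<lambda>y. q3_coeff y n)"
  by (rule linearI) auto

lemma linear_trace_mult: "linear (\<lambda>A :: complex ^ 3 ^ 3. trace (A ** B))"
  by (rule linearI) (simp_all add: trace_def matrix_matrix_mult_def sum_3 algebra_simps)

lemma linear_bloch: "linear (\<lambda>A. bloch A n)"
  by (rule linearI)
    (simp_all add: bloch_def linear_add[OF linear_trace_mult] linear_scale[OF linear_trace_mult] algebra_simps)

lemma linear_bloch_vec: "linear bloch_vec"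
  by (rule linearI)
    (simp_all add: bloch_vec_def linear_add[OF linear_bloch] linear_scale[OF linear_bloch]
      scaleR_left_distrib sum.distrib scaleR_sum_right)

lemma linear_bloch_mat: "linear bloch_mat"
  by (rule linearI)
    (simp_all add: bloch_mat_def scaleR_left_distrib sum.distrib scaleR_sum_right scaleR_right_distrib mult_ac)

lemma trace_gell_mann: "trace (gell_mann n) = 0"
  by (auto simp: trace_def sum_3 gell_mann_def)

lemma hermitian_gell_mann: "hermitian (gell_mann n)"
  unfolding hermitian_def by (auto simp: forall_3 gell_mann_def)

lemma hermitian_bloch_mat: "hermitian (bloch_mat y)"
  using hermitian_gell_mann by (simp add: hermitian_def bloch_mat_def)

lemma trace_bloch_mat: "trace (bloch_mat y) = 0"
proof -
  have "linear (\<lambda>A :: complex ^ 3 ^ 3. trace A)"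
    using linear_trace_mult[of "mat 1"] by simp
  then show ?thesis by (simp add: bloch_mat_def linear_scale linear_sum trace_gell_mann)
qed

text \<open>The constant is the square of \<open>1 / sqrt 3\<close> from \<open>bloch_mat\<close>
  times the normalisation 2 of the Gell-Mann traces.\<close>

lemma trace_bloch_mat_mult:
  "trace (bloch_mat x ** bloch_mat y) = of_real (2 / 3 * (x \<bullet> y))"
proof -
  have r: "linear (\<lambda>A :: complex ^ 3 ^ 3. trace (B ** A))" for B
    by (rule linearI) (simp_all add: trace_def matrix_matrix_mult_def sum_3 algebra_simps)
  have "trace (bloch_mat x ** bloch_mat y) =
      (1/3) *\<^sub>R (\<Sum>n=1..8. \<Sum>m=1..8. (q3_coeff x (n - 1) * q3_coeff y (m - 1)) *\<^sub>R trace (gell_mann n ** gell_mann m))"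
    unfolding bloch_mat_def linear_scale[OF linear_trace_mult] linear_scale[OF r]
      linear_sum[OF linear_trace_mult] linear_sum[OF r] scaleR_sum_right scaleR_scaleR
    by (subst sum.swap) (intro sum.cong refl, simp add: field_simps)
  also have "\<dots> = (1/3) *\<^sub>R (\<Sum>n=1..8. of_real (2 * (q3_coeff x (n - 1) * q3_coeff y (n - 1))))"
  proof -
    have "(\<Sum>m=1..8. (q3_coeff x (n - 1) * q3_coeff y (m - 1)) *\<^sub>R trace (gell_mann n ** gell_mann m)) =
      of_real (2 * (q3_coeff x (n - 1) * q3_coeff y (n - 1)))" if "n \<in> {1..8}" for n
    proof -
      have "(\<Sum>m=1..8. (q3_coeff x (n - 1) * q3_coeff y (m - 1)) *\<^sub>R trace (gell_mann n ** gell_mann m)) =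
        (\<Sum>m=1..8. if m = n then of_real (2 * (q3_coeff x (n - 1) * q3_coeff y (m - 1))) else 0)"
        using that by (intro sum.cong) (auto simp: gell_mann_trace scaleR_conv_of_real)
      then show ?thesis using that by simp
    qed
    then show ?thesis by simp
  qed
  also have "\<dots> = of_real (2 / 3 * (x \<bullet> y))"
  proof -
    have "(\<Sum>n=1..8. 2 * (q3_coeff x (n - 1) * q3_coeff y (n - 1))) = 2 * (x \<bullet> y)"
      unfolding inner_q3_def sum_distrib_left
      by (rule sum.reindex_bij_witness[of _ Suc "\<lambda>n. n - 1"]) auto
    then show ?thesis unfolding of_real_sum[symmetric] by (simp only: scaleR_conv_of_real of_real_mult [symmetric]) simp
  qed
  finally show ?thesis .
qed

text \<open>Each Gell-Mann matrix is \<open>sqrt 3\<close> times the \<open>bloch_mat\<close> of a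
  basis vector, so the trace form extracts a coefficient. The constants cancel:
  \<open>sqrt 3 / 2 * sqrt 3 * (2 / 3) = 1\<close>.\<close>

lemma bloch_vec_bloch_mat: "bloch_vec (bloch_mat y) = y"
proof -
  have "bloch (bloch_mat y) n = q3_coeff y (n - 1)" if n: "n \<in> {1..8}" for n
  proof -
    have "sqrt 3 *\<^sub>R bloch_mat (eps ^ (n - 1)) = (\<Sum>m=1..8. if m = n then gell_mann m else 0)"
    proof -
      have "sqrt 3 *\<^sub>R bloch_mat (eps ^ (n - 1)) = (\<Sum>m=1..8. q3_coeff (eps ^ (n - 1)) (m - 1) *\<^sub>R gell_mann m)"
        by (simp add: bloch_mat_def)
      also have "\<dots> = (\<Sum>m=1..8. if m = n then gell_mann m else 0)"
        using n by (intro sum.cong) (auto simp: q3_coeff_eps_power split: if_splits)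
      finally show ?thesis .
    qed
    then have g: "gell_mann n = sqrt 3 *\<^sub>R bloch_mat (eps ^ (n - 1))" using n by simp
    have i: "y \<bullet> eps ^ (n - 1) = q3_coeff y (n - 1)"
    proof -
      have "y \<bullet> eps ^ (n - 1) = (\<Sum>m<8. if m = n - 1 then q3_coeff y m else 0)"
        unfolding inner_q3_def by (intro sum.cong) (auto simp: q3_coeff_eps_power split: if_splits)
      then show ?thesis using n by auto
    qed
    have "trace (bloch_mat y ** gell_mann n) = sqrt 3 *\<^sub>R trace (bloch_mat y ** bloch_mat (eps ^ (n - 1)))"
      unfolding g by (simp add: trace_def matrix_matrix_mult_def sum_3 algebra_simps)
    then show ?thesis
      unfolding bloch_def trace_bloch_mat_mult i by simp
  qed
  then show ?thesis using q3_eq_eps_sum[of y] by (simp add: bloch_vec_def)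
qed

text \<open>By \<open>gell_mann_span\<close> the matrix lies in the range of
  \<open>bloch_mat\<close>, where a left inverse is also a right inverse.\<close>

lemma bloch_mat_bloch_vec:
  assumes "hermitian A" "trace A = 0"
  shows "bloch_mat (bloch_vec A) = A"
proof -
  obtain f :: "nat \<Rightarrow> real" where f: "A = (\<Sum>m=1..8. f m *\<^sub>R gell_mann m)"
    using gell_mann_span[OF assms(2)] assms(1) unfolding hermitian_def by auto
  define y where "y = (\<Sum>m=1..8. (sqrt 3 * f m) *\<^sub>R eps ^ (m - 1))"
  have "A = bloch_mat y"
    unfolding f y_def bloch_mat_def scaleR_sum_right
    by (intro sum.cong refl) (simp only: q3_coeff_eps_sum, simp)
  then show ?thesis by (simp add: bloch_vec_bloch_mat)
qed

lemma bloch_vec_mat_1: "bloch_vec (mat 1) = 0"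
  by (simp add: bloch_vec_def bloch_def trace_gell_mann)

lemma to_q3_of_q3 [simp]: "to_q3 (of_q3 y) = y"
  by (simp add: to_q3_def of_q3_def linear_add[OF linear_bloch_vec] linear_scale[OF linear_bloch_vec]
      bloch_vec_mat_1 bloch_vec_bloch_mat)

lemma hermitian_diff: "hermitian A \<Longrightarrow> hermitian B \<Longrightarrow> hermitian (A - B)"
  by (simp add: hermitian_def)

lemma hermitian_add: "hermitian A \<Longrightarrow> hermitian B \<Longrightarrow> hermitian (A + B)"
  by (simp add: hermitian_def)

lemma hermitian_scaleR: "hermitian A \<Longrightarrow> hermitian (c *\<^sub>R A)"
  by (simp add: hermitian_def)

lemma hermitian_mat_1: "hermitian (mat 1)"
  by (simp add: hermitian_def mat_def)

lemma hermitian_of_q3: "hermitian (of_q3 y)"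
  by (simp add: of_q3_def hermitian_add hermitian_scaleR hermitian_mat_1 hermitian_bloch_mat)

lemma trace_of_q3: "trace (of_q3 y) = 1"
proof -
  have "trace (of_q3 y) = (1 / 3 + 1 / 3 + 1 / 3) + trace (bloch_mat (y - origin))"
    unfolding trace_def sum_3 by (simp add: of_q3_def mat_def complex_eq_iff)
  then show ?thesis by (simp add: trace_bloch_mat)
qed

lemma of_q3_to_q3:
  assumes "hermitian A" "trace A = 1"
  shows "of_q3 (to_q3 A) = A"
proof -
  let ?B = "A - (1 / 3) *\<^sub>R mat 1"
  have "hermitian ?B" by (rule hermitian_diff[OF assms(1) hermitian_scaleR[OF hermitian_mat_1]])
  moreover have "trace ?B = 0"
  proof -
    have "trace ?B = trace A - (1 / 3 + 1 / 3 + 1 / 3)"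
      unfolding trace_def sum_3 by (simp add: mat_def complex_eq_iff)
    also have "\<dots> = 0" unfolding assms(2) by simp
    finally show ?thesis .
  qed
  ultimately have "bloch_mat (bloch_vec ?B) = ?B" by (rule bloch_mat_bloch_vec)
  moreover have "bloch_vec ?B = bloch_vec A"
    by (simp add: linear_diff[OF linear_bloch_vec] linear_scale[OF linear_bloch_vec] bloch_vec_mat_1)
  ultimately show ?thesis by (simp add: of_q3_def to_q3_def)
qed

lemma inner_bloch_vec:
  assumes "hermitian A" "trace A = 0" "hermitian B" "trace B = 0"
  shows "bloch_vec A \<bullet> bloch_vec B = 3 / 2 * Re (trace (A ** B))"
proof -
  have "trace (A ** B) = of_real (2 / 3 * (bloch_vec A \<bullet> bloch_vec B))"
    using trace_bloch_mat_mult[of "bloch_vec A" "bloch_vec B"]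
    by (simp only: bloch_mat_bloch_vec assms)
  from arg_cong[OF this, of Re] show ?thesis unfolding Re_complex_of_real by simp
qed


section \<open>The variety as the image of the density map\<close>

lemma norm_vector_smult: "norm (c *s v) = cmod c * norm (v :: complex ^ 'n)"
  unfolding norm_vec_def L2_set_def
  by (simp add: norm_mult power_mult_distrib real_sqrt_mult flip: sum_distrib_left)

lemma norm_power2_eq_sum: "(norm (v :: complex ^ 'n))\<^sup>2 = (\<Sum>i\<in>UNIV. (cmod (v $ i))\<^sup>2)"
  by (simp add: norm_vec_def L2_set_def sum_nonneg)

lemma braket_self: "braket v v = of_real ((norm v)\<^sup>2)"
  unfolding norm_power2_eq_sum braket_def of_real_sum
  by (intro sum.cong refl) (simp add: complex_norm_square mult.commute del: of_real_power)

lemma cnj_braket: "cnj (braket a b) = braket b a"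
  by (simp add: braket_def mult.commute)

lemma hermitian_ketbra: "hermitian (ketbra \<psi>)"
  by (simp add: hermitian_def ketbra_def mult.commute)

lemma trace_ketbra: "trace (ketbra \<psi>) = of_real ((norm \<psi>)\<^sup>2)"
  unfolding braket_self[symmetric] by (simp add: trace_def ketbra_def braket_def mult.commute)

lemma ketbra_smult: "ketbra (c *s v) = of_real ((cmod c)\<^sup>2) *\<^sub>R ketbra v"
proof -
  have "c * a * (cnj c * b) = (cmod c)\<^sup>2 *\<^sub>R (a * b)" for a b
    by (simp add: scaleR_conv_of_real complex_norm_square mult_ac del: of_real_power)
  then show ?thesis by (simp add: ketbra_def vec_eq_iff)
qed

lemma line_smult:
  assumes "c \<noteq> 0"
  shows "line (c *s v) = line v"
proof -
  have "k *s v = (k / c) *s (c *s v)" for k using assms by simp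
  then have "k *s v \<in> line (c *s v)" for k
    unfolding line_def vec.span_singleton by (metis rangeI)
  moreover have "k *s (c *s v) \<in> line v" for k
    unfolding line_def vec.span_singleton by (auto simp: vector_smult_assoc)
  ultimately show ?thesis
    unfolding line_def vec.span_singleton by (metis (no_types, lifting) imageE subsetI subset_antisym)
qed

lemma mem_line: "\<phi> \<in> line \<psi> \<longleftrightarrow> (\<exists>c. \<phi> = c *s \<psi>)"
  by (auto simp: line_def vec.span_singleton)

lemma line_eqI: "\<phi> \<in> line \<psi> \<Longrightarrow> \<phi> \<noteq> 0 \<Longrightarrow> line \<phi> = line \<psi>"
  by (auto simp: mem_line line_smult)

lemma line_in_proj_space: "v \<noteq> 0 \<Longrightarrow> line v \<in> proj_space"
  by (simp add: proj_space_def line_def vec.subspace_span)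

lemma proj_spaceE:
  assumes "L \<in> proj_space"
  obtains v where "v \<noteq> 0" "L = line v"
proof -
  have L: "vec.subspace L" "vec.dim L = 1" using assms by (auto simp: proj_space_def)
  obtain B where B: "B \<subseteq> L" "vec.independent B" "L \<subseteq> vec.span B" "card B = vec.dim L"
    by (rule vec.basis_exists)
  then obtain v where v: "B = {v}" using L(2) by (auto simp: card_1_singleton_iff)
  have "L = line v"
    using B(1,3) L(1) unfolding v line_def by (simp add: subset_antisym vec.span_minimal)
  moreover have "v \<noteq> 0" using B(2) v vec.dependent_zero[of B] by auto
  ultimately show ?thesis using that by blast
qed

lemma unit_vector_exists:
  assumes "v \<noteq> 0"
  obtains \<psi> where "norm \<psi> = 1" "line \<psi> = line v" "\<psi> = complex_of_real (inverse (norm v)) *s v"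
proof (rule that)
  let ?\<psi> = "complex_of_real (inverse (norm v)) *s v"
  show "norm ?\<psi> = 1" using assms unfolding norm_vector_smult norm_of_real by simp
  show "line ?\<psi> = line v" using assms by (intro line_smult) auto
qed simp

lemma proj_space_unitE:
  assumes "L \<in> proj_space"
  obtains \<psi> where "norm \<psi> = 1" "L = line \<psi>"
  using proj_spaceE[OF assms] unit_vector_exists by metis

lemma density_map_unit: "norm \<psi> = 1 \<Longrightarrow> density_map (line \<psi>) = to_q3 (ketbra \<psi>)"
  by (simp add: density_map_def state_projector_line to_q3_eq)

text \<open>This form needs no normalised representative and is rational in the real and imaginary
  parts of \<open>v\<close>, which makes continuity and smoothness away from 0 visible.\<close>

lemma density_map_line:
  assumes "v \<noteq> 0"
  shows "density_map (line v) = to_q3 (inverse ((norm v)\<^sup>2) *\<^sub>R ketbra v)"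
proof -
  obtain \<psi> where \<psi>: "norm \<psi> = 1" "line \<psi> = line v" "\<psi> = complex_of_real (inverse (norm v)) *s v"
    using assms by (rule unit_vector_exists)
  have "density_map (line v) = to_q3 (ketbra \<psi>)" using \<psi> density_map_unit by metis
  also have "ketbra \<psi> = inverse ((norm v)\<^sup>2) *\<^sub>R ketbra v"
    unfolding \<psi>(3) ketbra_smult by (simp add: norm_inverse power_inverse)
  finally show ?thesis .
qed

lemma of_q3_density_map_unit: "norm \<psi> = 1 \<Longrightarrow> of_q3 (density_map (line \<psi>)) = ketbra \<psi>"
  by (simp add: density_map_unit of_q3_to_q3 hermitian_ketbra trace_ketbra)

lemma of_q3_density_map:
  assumes "v \<noteq> 0"
  shows "of_q3 (density_map (line v)) = inverse ((norm v)\<^sup>2) *\<^sub>R ketbra v"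
proof -
  have "trace (inverse ((norm v)\<^sup>2) *\<^sub>R ketbra v) = inverse ((norm v)\<^sup>2) *\<^sub>R trace (ketbra v)"
    by (simp add: trace_def scaleR_sum_right)
  also have "\<dots> = 1" using assms unfolding trace_ketbra by (simp add: scaleR_conv_of_real)
  finally show ?thesis
    using assms by (simp add: density_map_line of_q3_to_q3 hermitian_scaleR hermitian_ketbra)
qed

lemma ketbra_mult_vector: "ketbra \<psi> *v \<phi> = braket \<psi> \<phi> *s \<psi>"
  by (simp add: ketbra_def matrix_vector_mult_def braket_def vec_eq_iff sum_distrib_left sum_distrib_right mult_ac)

text \<open>Equal projectors applied to \<open>\<phi>\<close> give a multiple of
  \<open>\<psi>\<close> on one side and \<open>\<phi>\<close> itself on the other.\<close>

lemma inj_on_density_map: "inj_on density_map proj_space"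
proof (rule inj_onI)
  fix L M assume *: "L \<in> proj_space" "M \<in> proj_space" "density_map L = density_map M"
  obtain \<psi> \<phi> where \<psi>: "norm \<psi> = 1" "L = line \<psi>" and \<phi>: "norm \<phi> = 1" "M = line \<phi>"
    using *(1,2) proj_space_unitE by metis
  have "ketbra \<psi> = ketbra \<phi>" using * \<psi> \<phi> of_q3_density_map_unit by metis
  then have "ketbra \<psi> *v \<phi> = ketbra \<phi> *v \<phi>" by simp
  then have "\<phi> = braket \<psi> \<phi> *s \<psi>" by (simp add: ketbra_mult_vector braket_self \<phi>)
  then have "\<phi> \<in> line \<psi>" by (auto simp: mem_line)
  moreover have "\<phi> \<noteq> 0" using \<phi>(1) by auto
  ultimately show "L = M" using \<psi> \<phi> line_eqI by metis
qed

section \<open>Rank-one idempotents and the equations of the variety\<close>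

lemma linear_matrix_mult_left: "linear (\<lambda>A :: complex ^ 'n ^ 'm. A ** (B :: complex ^ 'k ^ 'n))"
  by (rule linearI) (simp_all add: vec_eq_iff matrix_matrix_mult_def scaleR_sum_right sum.distrib algebra_simps)

lemma linear_matrix_mult_right: "linear (\<lambda>A :: complex ^ 'k ^ 'n. (B :: complex ^ 'n ^ 'm) ** A)"
  by (rule linearI) (simp_all add: vec_eq_iff matrix_matrix_mult_def scaleR_sum_right sum.distrib algebra_simps)

lemma mult_ketbra: "A ** ketbra \<psi> = (\<chi> i j. (A *v \<psi>) $ i * cnj (\<psi> $ j))"
  by (simp add: vec_eq_iff matrix_matrix_mult_def matrix_vector_mult_def ketbra_def sum_distrib_right mult.assoc)

lemma ketbra_idempotent:
  assumes "norm \<psi> = 1"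
  shows "ketbra \<psi> ** ketbra \<psi> = ketbra \<psi>"
  using assms by (simp add: mult_ketbra ketbra_mult_vector braket_self) (simp add: ketbra_def)

lemma hermitian_mult_swap:
  assumes "hermitian A" "hermitian B"
  shows "(A ** B) $ i $ j = cnj ((B ** A) $ j $ i)"
  using assms by (simp add: matrix_matrix_mult_def hermitian_def mult.commute)

text \<open>
  A normalised column \<open>\<psi>\<close> of \<open>A\<close> is fixed by \<open>A\<close>, so \<open>S = A - |\<psi>\<rangle>\<langle>\<psi>|\<close> is again a Hermitian idempotent; its
  trace, which is its squared Frobenius norm, vanishes.
\<close>

lemma hermitian_idempotent_rank_one:
  fixes A :: "complex ^ 3 ^ 3"
  assumes A: "hermitian A" "A ** A = A" "trace A = 1"
  obtains \<psi> where "norm \<psi> = 1" "A = ketbra \<psi>"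
proof -
  have "\<exists>i. A $ i $ i \<noteq> 0"
  proof (rule ccontr)
    assume "\<not> ?thesis"
    then have "trace A = 0" by (simp add: trace_def)
    then show False using A(3) by simp
  qed
  then obtain i where i: "A $ i $ i \<noteq> 0" by blast
  have ent: "(\<Sum>k\<in>UNIV. A $ a $ k * A $ k $ b) = A $ a $ b" for a b
    using arg_cong[OF A(2), of "\<lambda>M. M $ a $ b"] by (simp add: matrix_matrix_mult_def)
  define v where "v = (\<chi> j. A $ j $ i)"
  \<comment> \<open>As \<open>A\<close> is Hermitian, the squared norm of its column
    \<open>i\<close> is the diagonal entry of \<open>A ** A = A\<close>; so the column is
    nonzero.\<close>
  have nv: "complex_of_real ((norm v)\<^sup>2) = A $ i $ i"
    using ent[of i i] A(1) unfolding braket_self[symmetric] by (simp add: v_def braket_def hermitian_def)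
  have "v \<noteq> 0" using nv i by auto
  then obtain \<psi> where \<psi>: "norm \<psi> = 1" "\<psi> = complex_of_real (inverse (norm v)) *s v"
    using unit_vector_exists by metis
  have "A *v v = v" using ent by (simp add: v_def matrix_vector_mult_def vec_eq_iff)
  then have "A *v \<psi> = \<psi>" unfolding \<psi>(2) by (simp add: vec.scale)
  then have AP: "A ** ketbra \<psi> = ketbra \<psi>"
    by (simp add: mult_ketbra) (simp add: ketbra_def)
  then have PA: "ketbra \<psi> ** A = ketbra \<psi>"
    using hermitian_mult_swap[OF hermitian_ketbra A(1)] hermitian_ketbra[of \<psi>]
    by (simp add: vec_eq_iff hermitian_def)
  note PP = ketbra_idempotent[OF \<psi>(1)]
  define S where "S = A - ketbra \<psi>"
  have "S ** S = S"
    unfolding S_def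
    by (simp add: linear_diff[OF linear_matrix_mult_left] linear_diff[OF linear_matrix_mult_right] AP PA PP A(2))
  moreover have "trace S = 0" 
    using A(3) trace_ketbra[of \<psi>] \<psi>(1) by (simp add: S_def trace_def sum_subtractf)
  ultimately have "trace (S ** S) = 0" by simp
  moreover have "cnj (S $ a $ b) = S $ b $ a" for a b
    using A(1) hermitian_ketbra[of \<psi>] by (simp add: S_def hermitian_def)
  then have "S $ a $ b * S $ b $ a = of_real ((cmod (S $ a $ b))\<^sup>2)" for a b
    by (metis complex_norm_square)
  ultimately have "(\<Sum>a\<in>UNIV. \<Sum>b\<in>UNIV. of_real ((cmod (S $ a $ b))\<^sup>2)) = (0 :: complex)"
    by (simp add: trace_def matrix_matrix_mult_def)
  then have "(\<Sum>a\<in>UNIV. \<Sum>b\<in>UNIV. (cmod (S $ a $ b))\<^sup>2) = 0"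
    unfolding of_real_sum[symmetric] of_real_eq_0_iff .
  then have "S = 0"
    by (simp add: sum_nonneg_eq_0_iff sum_nonneg vec_eq_iff)
  then show ?thesis using that \<psi>(1) by (simp add: S_def)
qed

text \<open>The coefficients \<open>gell_mann_d\<close> describe anticommutators only. The weights
  \<open>x j * x k\<close> are symmetric, so each product may be replaced by half an anticommutator;
  with the prefactor 1/3 this turns 4/3 and 2 into 2/9 and 1/3.\<close>

lemma bloch_mat_square:
  "bloch_mat z ** bloch_mat z = (2 / 9 * (z \<bullet> z)) *\<^sub>R mat 1 +
     (\<Sum>l=1..8. (1 / 3 * (\<Sum>j=1..8. \<Sum>k=1..8. gell_mann_d j k l * q3_coeff z (j - 1) * q3_coeff z (k - 1))) *\<^sub>R gell_mann l)"
proof -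
  define x where "x = (\<lambda>n. q3_coeff z (n - 1))"
  let ?P = "\<lambda>j k. gell_mann j ** gell_mann k"
  have "bloch_mat z ** bloch_mat z = (1 / 3) *\<^sub>R (\<Sum>j=1..8. \<Sum>k=1..8. (x j * x k) *\<^sub>R ?P j k)"
    unfolding bloch_mat_def linear_scale[OF linear_matrix_mult_left] linear_scale[OF linear_matrix_mult_right]
      linear_sum[OF linear_matrix_mult_left] linear_sum[OF linear_matrix_mult_right] scaleR_sum_right scaleR_scaleR x_def
    by (subst sum.swap) (intro sum.cong refl, simp add: field_simps)
  also have "(\<Sum>j=1..8. \<Sum>k=1..8. (x j * x k) *\<^sub>R ?P j k) =
      (1 / 2) *\<^sub>R (\<Sum>j=1..8. \<Sum>k=1..8. (x j * x k) *\<^sub>R (?P j k + ?P k j))"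
  proof -
    have "(\<Sum>j=1..8. \<Sum>k=1..8. (x j * x k) *\<^sub>R ?P k j) = (\<Sum>j=1..8. \<Sum>k=1..8. (x j * x k) *\<^sub>R ?P j k)"
      by (subst sum.swap) (simp add: mult.commute)
    then show ?thesis
      by (simp only: scaleR_right_distrib sum.distrib) (simp flip: scaleR_left_distrib)
  qed
  also have "(\<Sum>j=1..8. \<Sum>k=1..8. (x j * x k) *\<^sub>R (?P j k + ?P k j)) =
      (\<Sum>j=1..8. \<Sum>k=1..8. (x j * x k * (4 / 3 * (if j = k then 1 else 0))) *\<^sub>R mat 1) +
      2 *\<^sub>R (\<Sum>j=1..8. \<Sum>k=1..8. \<Sum>l=1..8. (gell_mann_d j k l * x j * x k) *\<^sub>R gell_mann l)"
    unfolding scaleR_sum_right sum.distrib[symmetric]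
    by (intro sum.cong refl, subst gell_mann_d_relation, assumption, assumption)
      (simp only: scaleR_right_distrib scaleR_sum_right scaleR_scaleR mult_ac)
  also have "(\<Sum>j=1..8. \<Sum>k=1..8. (x j * x k * (4 / 3 * (if j = k then 1 else 0))) *\<^sub>R mat 1) =
      (4 / 3 * (z \<bullet> z)) *\<^sub>R (mat 1 :: complex ^ 3 ^ 3)"
  proof -
    have "(\<Sum>k=1..8. x j * x k * (4 / 3 * (if j = k then 1 else 0))) = 4 / 3 * (x j * x j)" if "j \<in> {1..8}" for j
    proof -
      have "(\<Sum>k=1..8. x j * x k * (4 / 3 * (if j = k then 1 else 0))) = (\<Sum>k=1..8. if j = k then 4 / 3 * (x j * x k) else 0)"
        by (intro sum.cong) auto
      then show ?thesis using that by simp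
    qed
    moreover have "(\<Sum>j=1..8. 4 / 3 * (x j * x j)) = 4 / 3 * (z \<bullet> z)"
      unfolding inner_q3_def sum_distrib_left x_def
      by (rule sum.reindex_bij_witness[of _ Suc "\<lambda>n. n - 1"]) auto
    ultimately have "(\<Sum>j=1..8. \<Sum>k=1..8. x j * x k * (4 / 3 * (if j = k then 1 else 0))) = 4 / 3 * (z \<bullet> z)"
      by (subst sum.cong[OF refl]) assumption+
    then show ?thesis by (simp only: flip: scaleR_sum_left)
  qed
  also have "(\<Sum>j=1..8. \<Sum>k=1..8. \<Sum>l=1..8. (gell_mann_d j k l * x j * x k) *\<^sub>R gell_mann l) =
      (\<Sum>l=1..8. (\<Sum>j=1..8. \<Sum>k=1..8. gell_mann_d j k l * x j * x k) *\<^sub>R gell_mann l)"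
    unfolding scaleR_sum_left
    by (subst sum.swap, subst (2) sum.swap, subst sum.swap) (rule sum.swap)
  finally show ?thesis
    by (simp add: scaleR_right_distrib scaleR_sum_right x_def)
qed

text \<open>Expanding \<open>A ** A - A\<close> leaves a multiple of the unit matrix and a real
  combination of Gell-Mann matrices. The trace isolates the first part, which is the sphere
  equation; linear independence of the \<open>\<lambda>\<close>-part then gives one quadratic
  equation for each \<open>l\<close>.\<close>

lemma of_q3_idempotent_iff:
  assumes z: "z = y - origin"
  shows "of_q3 y ** of_q3 y = of_q3 y \<longleftrightarrow> z \<bullet> z = 1 \<and>
    (\<forall>l\<in>{1..8}. (\<Sum>j=1..8. \<Sum>k=1..8. gell_mann_d j k l * q3_coeff z (j - 1) * q3_coeff z (k - 1)) =
      1 / sqrt 3 * q3_coeff z (l - 1))"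
    (is "_ \<longleftrightarrow> _ \<and> (\<forall>l\<in>_. ?D l = _)")
proof -
  let ?I = "mat 1 :: complex ^ 3 ^ 3"
  define f where "f = (\<lambda>l. 1 / 3 * (?D l - 1 / sqrt 3 * q3_coeff z (l - 1)))"
  have s3: "1 / 3 * (1 / sqrt 3) = 1 / sqrt 3 - 2 / 3 * (1 / sqrt 3)" by simp
  have "of_q3 y ** of_q3 y - of_q3 y =
      (2 / 9 * (z \<bullet> z - 1)) *\<^sub>R ?I + (bloch_mat z ** bloch_mat z - (2 / 9 * (z \<bullet> z)) *\<^sub>R ?I - (1 / 3) *\<^sub>R bloch_mat z)"
    unfolding of_q3_def z[symmetric]
    by (simp add: linear_add[OF linear_matrix_mult_left] linear_add[OF linear_matrix_mult_right]
      linear_scale[OF linear_matrix_mult_left] linear_scale[OF linear_matrix_mult_right])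
      (simp add: vec_eq_iff complex_eq_iff field_simps)
  also have "bloch_mat z ** bloch_mat z - (2 / 9 * (z \<bullet> z)) *\<^sub>R ?I - (1 / 3) *\<^sub>R bloch_mat z = (\<Sum>l=1..8. f l *\<^sub>R gell_mann l)"
    unfolding bloch_mat_square f_def unfolding bloch_mat_def right_diff_distrib scaleR_left_diff_distrib sum_subtractf
    by (simp add: scaleR_sum_right mult_ac)
  finally have *: "of_q3 y ** of_q3 y - of_q3 y = (2 / 9 * (z \<bullet> z - 1)) *\<^sub>R ?I + (\<Sum>l=1..8. f l *\<^sub>R gell_mann l)" .
  show ?thesis
  proof
    assume "of_q3 y ** of_q3 y = of_q3 y"
    then have 0: "(2 / 9 * (z \<bullet> z - 1)) *\<^sub>R ?I + (\<Sum>l=1..8. f l *\<^sub>R gell_mann l) = 0" using * by simp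
    have lt: "linear (\<lambda>A :: complex ^ 3 ^ 3. trace A)"
      using linear_trace_mult[of "mat 1"] by simp
    have "trace ((2 / 9 * (z \<bullet> z - 1)) *\<^sub>R ?I + (\<Sum>l=1..8. f l *\<^sub>R gell_mann l)) = (2 / 9 * (z \<bullet> z - 1)) *\<^sub>R 3"
      unfolding linear_add[OF lt] linear_scale[OF lt] linear_sum[OF lt]
      by (simp add: trace_gell_mann trace_I)
    then have zz: "z \<bullet> z = 1" using 0 linear_0[OF lt] by simp
    then have "(\<Sum>l=1..8. f l *\<^sub>R gell_mann l) = (\<Sum>l=1..8. 0 *\<^sub>R gell_mann l)" using 0 by simp
    then have "f l = 0" if "l \<in> {1..8}" for l using gell_mann_independent[of f "\<lambda>_. 0"] that by blast
    then show "z \<bullet> z = 1 \<and> (\<forall>l\<in>{1..8}. ?D l = 1 / sqrt 3 * q3_coeff z (l - 1))"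
      using zz unfolding f_def by simp
  next
    assume "z \<bullet> z = 1 \<and> (\<forall>l\<in>{1..8}. ?D l = 1 / sqrt 3 * q3_coeff z (l - 1))"
    then have "z \<bullet> z = 1" "\<And>l. l \<in> {1..8} \<Longrightarrow> f l = 0" unfolding f_def by auto
    then show "of_q3 y ** of_q3 y = of_q3 y" using * by simp
  qed
qed

text \<open>The set comprehension ranges over functions on all naturals, but \<open>y\<close> fixes
  the witness at the indices 1 to 8 and the equations read no others. The existential thus becomes a
  condition on coefficients.\<close>

lemma mem_state_variety_iff:
  assumes z: "z = y - origin"
  shows "y \<in> state_variety \<longleftrightarrow> z \<bullet> z = 1 \<and>
    (\<forall>l\<in>{1..8}. (\<Sum>j=1..8. \<Sum>k=1..8. gell_mann_d j k l * q3_coeff z (j - 1) * q3_coeff z (k - 1)) =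
      1 / sqrt 3 * q3_coeff z (l - 1))"
proof -
  have zz: "z \<bullet> z = (\<Sum>n=1..8. (q3_coeff z (n - 1))\<^sup>2)"
    unfolding inner_q3_def
    by (rule sum.reindex_bij_witness[of _ "\<lambda>n. n - 1" Suc]) (auto simp: power2_eq_square)
  have rep: "y = q3_point (\<lambda>n. q3_coeff z (n - 1))"
    unfolding q3_point_eq q3_eq_eps_sum by (simp add: z)
  have co: "x n = q3_coeff z (n - 1)" if "y = q3_point x" "n \<in> {1..8}" for x n
    using q3_coeff_eps_sum[OF that(2), of x] that(1) by (simp add: z q3_point_eq)
  show ?thesis
  proof
    assume "y \<in> state_variety"
    then obtain x where x: "y = q3_point x" "(\<Sum>n=1..8. (x n)\<^sup>2) = 1"
      "\<forall>l\<in>{1..8}. (\<Sum>j=1..8. \<Sum>k=1..8. gell_mann_d j k l * x j * x k) = 1 / sqrt 3 * x l"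
      unfolding state_variety_def by blast
    have "(\<Sum>n=1..8. (q3_coeff z (n - 1))\<^sup>2) = (\<Sum>n=1..8. (x n)\<^sup>2)"
      by (intro sum.cong refl) (simp only: co[OF x(1)])
    moreover have "(\<Sum>j=1..8. \<Sum>k=1..8. gell_mann_d j k l * q3_coeff z (j - 1) * q3_coeff z (k - 1)) =
        (\<Sum>j=1..8. \<Sum>k=1..8. gell_mann_d j k l * x j * x k)" for l
      by (intro sum.cong refl) (simp only: co[OF x(1)])
    ultimately show "z \<bullet> z = 1 \<and> (\<forall>l\<in>{1..8}. (\<Sum>j=1..8. \<Sum>k=1..8. gell_mann_d j k l * q3_coeff z (j - 1) * q3_coeff z (k - 1)) =
      1 / sqrt 3 * q3_coeff z (l - 1))"
      using x(2,3) co[OF x(1)] unfolding zz by simp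
  next
    assume "z \<bullet> z = 1 \<and> (\<forall>l\<in>{1..8}. (\<Sum>j=1..8. \<Sum>k=1..8. gell_mann_d j k l * q3_coeff z (j - 1) * q3_coeff z (k - 1)) =
      1 / sqrt 3 * q3_coeff z (l - 1))"
    then show "y \<in> state_variety" using rep unfolding zz state_variety_def by blast
  qed
qed

lemma state_variety_eq: "state_variety = {y. of_q3 y ** of_q3 y = of_q3 y}"
  using mem_state_variety_iff of_q3_idempotent_iff by blast

lemma density_map_image: "density_map ` proj_space = state_variety"
proof (intro equalityI subsetI)
  fix y assume "y \<in> density_map ` proj_space"
  then obtain \<psi> where "norm \<psi> = 1" "y = density_map (line \<psi>)" using proj_space_unitE by (metis imageE)
  then show "y \<in> state_variety" by (simp add: state_variety_eq of_q3_density_map_unit ketbra_idempotent)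
next
  fix y assume "y \<in> state_variety"
  then obtain \<psi> where \<psi>: "norm \<psi> = 1" "of_q3 y = ketbra \<psi>"
    using hermitian_idempotent_rank_one[OF hermitian_of_q3 _ trace_of_q3] by (auto simp: state_variety_eq)
  then have "y = density_map (line \<psi>)" by (metis density_map_unit to_q3_of_q3)
  moreover have "line \<psi> \<in> proj_space" using \<psi>(1) by (intro line_in_proj_space) auto
  ultimately show "y \<in> density_map ` proj_space" by blast
qed

lemma real_algebraic_state_variety: "real_algebraic_set state_variety"
proof -
  have p: "real_polynomial_function (\<lambda>y. q3_coeff (y - origin) n)" for n
  proof -
    have "bounded_linear (\<lambda>y. q3_coeff y n)" using linear_q3_coeff linear_conv_bounded_linear by blast
    then have "real_polynomial_function (\<lambda>y. q3_coeff y n - q3_coeff origin n)"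
      by (intro real_polynomial_function_diff real_polynomial_function.intros)
    then show ?thesis by simp
  qed
  let ?g = "\<lambda>l y. (\<Sum>j=1..8. \<Sum>k=1..8. gell_mann_d j k l * q3_coeff (y - origin) (j - 1) * q3_coeff (y - origin) (k - 1)) -
      1 / sqrt 3 * q3_coeff (y - origin) (l - 1)"
  let ?h = "\<lambda>y. (\<Sum>n<8. q3_coeff (y - origin) n * q3_coeff (y - origin) n) - 1"
  have "state_variety = {y. \<forall>f\<in>insert ?h (?g ` {1..8}). f y = 0}"
    using mem_state_variety_iff[OF refl] by (auto simp: inner_q3_def)
  moreover have "finite (insert ?h (?g ` {1..8}))" by simp
  moreover have "real_polynomial_function (?g l)" for l
    by (intro real_polynomial_function_diff real_polynomial_function_sum real_polynomial_function.intros(2-) p) auto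
  moreover have "real_polynomial_function ?h"
    by (intro real_polynomial_function_diff real_polynomial_function_sum real_polynomial_function.intros(2-) p) auto
  ultimately show ?thesis unfolding real_algebraic_set_def by blast
qed


section \<open>Infinitesimal and topological properties of the density map\<close>

text \<open>Polarises \<open>ketbra\<close> for the product rule. It is conjugate linear in the
  second argument, hence bilinear over the reals only, which suffices for real derivatives.\<close>

definition ket_bra :: "complex ^ 3 \<Rightarrow> complex ^ 3 \<Rightarrow> complex ^ 3 ^ 3" where
  "ket_bra a b = (\<chi> i j. a $ i * cnj (b $ j))"

lemma ketbra_eq_ket_bra: "ketbra \<psi> = ket_bra \<psi> \<psi>"
  by (simp add: ketbra_def ket_bra_def)

lemma bounded_bilinear_ket_bra: "bounded_bilinear ket_bra"
  unfolding bilinear_conv_bounded_bilinear[symmetric] bilinear_def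
  by (intro conjI allI linearI) (simp_all add: ket_bra_def vec_eq_iff algebra_simps)

lemma smooth_on_ketbra: "open S \<Longrightarrow> smooth_on S f \<Longrightarrow> smooth_on S (\<lambda>x. ketbra (f x))"
  unfolding ketbra_eq_ket_bra by (rule smooth_on_bilinear[OF _ bounded_bilinear_ket_bra])

lemma smooth_on_to_q3: "open S \<Longrightarrow> smooth_on S f \<Longrightarrow> smooth_on S (\<lambda>x. to_q3 (f x))"
  unfolding to_q3_def
  by (intro smooth_on_add smooth_on_const) (auto intro: smooth_on_linear_compose linear_bloch_vec)

lemma smooth_on_of_q3: "smooth_on UNIV of_q3"
  unfolding of_q3_def
  by (intro smooth_on_add smooth_on_const smooth_on_linear_compose[OF _ linear_bloch_mat] smooth_on_diff
      smooth_on_linear linear_id[unfolded id_def] open_UNIV)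

lemma to_q3_ketbra_has_derivative:
  assumes "(\<psi> has_derivative D) (at x)"
  shows "((\<lambda>z. to_q3 (ketbra (\<psi> z))) has_derivative
    (\<lambda>u. bloch_vec (ket_bra (\<psi> x) (D u) + ket_bra (D u) (\<psi> x)))) (at x)"
proof -
  have bl: "bounded_linear bloch_vec"
    using linear_bloch_vec linear_conv_bounded_linear by blast
  have "((\<lambda>z. ketbra (\<psi> z)) has_derivative (\<lambda>u. ket_bra (\<psi> x) (D u) + ket_bra (D u) (\<psi> x))) (at x)"
    unfolding ketbra_eq_ket_bra by (rule bounded_bilinear.FDERIV[OF bounded_bilinear_ket_bra assms assms])
  from bounded_linear.has_derivative[OF bl this] show ?thesis
    unfolding to_q3_def by (rule has_derivative_add[OF has_derivative_const, of _ _ _ origin, simplified])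
qed

lemma inner_eq_Re_braket: "a \<bullet> b = Re (braket a b)"
  by (simp add: inner_vec_def braket_def inner_complex_def)

text \<open>Differentiate the constant squared norm. Only the real part vanishes; the imaginary part
  depends on the phase of the section and is what the second term of \<open>fs_form\<close>
  removes.\<close>

lemma unit_section_orthogonal:
  assumes "(\<psi> has_derivative D) (at x)" "open V" "x \<in> V" "\<And>z. z \<in> V \<Longrightarrow> norm (\<psi> z) = 1"
  shows "Re (braket (\<psi> x) (D u)) = 0"
proof -
  have "((\<lambda>z. \<psi> z \<bullet> \<psi> z) has_derivative (\<lambda>u. \<psi> x \<bullet> D u + D u \<bullet> \<psi> x)) (at x)"
    by (rule has_derivative_inner[OF assms(1,1)])
  then have "((\<lambda>z. 1) has_derivative (\<lambda>u. \<psi> x \<bullet> D u + D u \<bullet> \<psi> x)) (at x)"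
    by (rule has_derivative_transform_within_open[OF _ assms(2,3)])
      (use assms(4) in \<open>simp flip: power2_norm_eq_inner\<close>)
  then have "(\<lambda>u. \<psi> x \<bullet> D u + D u \<bullet> \<psi> x) = (\<lambda>u. 0)"
    by (rule has_derivative_unique) simp
  from fun_cong[OF this, of u] show ?thesis
    by (simp add: inner_commute flip: inner_eq_Re_braket)
qed

text \<open>The trace of the product has four terms. As the brackets of \<open>\<psi>\<close> with
  \<open>a\<close> and \<open>b\<close> are purely imaginary, the two terms built from both brackets
  each equal the subtracted term of \<open>fs_form\<close>, sign included. The real part of the
  trace is therefore twice the form, and 3/2 times 2 is the conformal factor.\<close>

lemma inner_bloch_vec_ket_bra:
  assumes "norm \<psi> = 1" and a: "Re (braket \<psi> a) = 0" and b: "Re (braket \<psi> b) = 0"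
  shows "bloch_vec (ket_bra \<psi> a + ket_bra a \<psi>) \<bullet> bloch_vec (ket_bra \<psi> b + ket_bra b \<psi>) = 3 * fs_form \<psi> a b"
proof -
  have herm: "hermitian (ket_bra \<psi> c + ket_bra c \<psi>)" for c
    by (simp add: hermitian_def ket_bra_def algebra_simps)
  have tr: "trace (ket_bra \<psi> c + ket_bra c \<psi>) = 0" if "Re (braket \<psi> c) = 0" for c
  proof -
    have "trace (ket_bra \<psi> c + ket_bra c \<psi>) = braket c \<psi> + braket \<psi> c"
      by (simp add: trace_def ket_bra_def braket_def sum.distrib mult.commute)
    also have "\<dots> = 0" using that unfolding cnj_braket[of \<psi> c, symmetric] by (simp add: complex_eq_iff)
    finally show ?thesis .
  qed
  have one: "braket \<psi> \<psi> = 1" using assms(1) by (simp add: braket_self)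
  have "trace ((ket_bra \<psi> a + ket_bra a \<psi>) ** (ket_bra \<psi> b + ket_bra b \<psi>)) =
      braket \<psi> a * braket \<psi> b + braket b a * braket \<psi> \<psi> + braket \<psi> \<psi> * braket a b + braket a \<psi> * braket b \<psi>"
    by (simp add: trace_def matrix_matrix_mult_def ket_bra_def braket_def sum_3 algebra_simps)
  then have "Re (trace ((ket_bra \<psi> a + ket_bra a \<psi>) ** (ket_bra \<psi> b + ket_bra b \<psi>))) = 2 * fs_form \<psi> a b"
    using a b unfolding one fs_form_def cnj_braket[of \<psi> a, symmetric] cnj_braket[of \<psi> b, symmetric] cnj_braket[of a b, symmetric]
    by simp
  then show ?thesis
    by (simp add: inner_bloch_vec herm tr a b)
qed

section \<open>Topology of the projective plane\<close>

lemma topspace_proj_topology [simp]: "topspace proj_topology = proj_space"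
proof (rule subset_antisym)
  show "topspace proj_topology \<subseteq> proj_space"
    by (auto simp: topspace_def openin_proj_topology)
  have "{v :: complex ^ 3. v \<noteq> 0 \<and> line v \<in> proj_space} = - {0}"
    using line_in_proj_space by auto
  then have "openin proj_topology proj_space" by (simp add: openin_proj_topology open_Compl)
  then show "proj_space \<subseteq> topspace proj_topology" by (rule openin_subset)
qed

lemma continuous_map_line: "continuous_map (top_of_set (- {0})) proj_topology line"
  unfolding continuous_map_def
proof (intro conjI allI impI)
  fix S assume "openin proj_topology S"
  then have "open {v. v \<noteq> 0 \<and> line v \<in> S}" by (simp add: openin_proj_topology)
  moreover have "{v \<in> topspace (top_of_set (- {0})). line v \<in> S} = {v. v \<noteq> 0 \<and> line v \<in> S}" by auto
  ultimately show "openin (top_of_set (- {0})) {v \<in> topspace (top_of_set (- {0})). line v \<in> S}"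
    by (auto intro: open_subset)
qed (auto simp: line_in_proj_space)

lemma smooth_on_to_q3_ketbra:
  "smooth_on (- {0 :: complex ^ 3}) (\<lambda>v. to_q3 (inverse ((norm v)\<^sup>2) *\<^sub>R ketbra v))"
proof -
  have id: "smooth_on (- {0 :: complex ^ 3}) (\<lambda>v. v)" by (rule smooth_on_linear[OF linear_id[unfolded id_def]])
  show ?thesis
    unfolding power2_norm_eq_inner
    by (intro smooth_on_to_q3 smooth_on_scaleR smooth_on_ketbra smooth_on_inverse smooth_on_inner id) auto
qed

lemma continuous_map_density_map: "continuous_map proj_topology euclidean density_map"
  unfolding continuous_map_def
proof (intro conjI allI impI)
  fix S :: "q3 set" assume "openin euclidean S"
  then have "open S" by simp
  let ?f = "\<lambda>v :: complex ^ 3. to_q3 (inverse ((norm v)\<^sup>2) *\<^sub>R ketbra v)"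
  have "{v. v \<noteq> 0 \<and> line v \<in> {L \<in> proj_space. density_map L \<in> S}} = - {0} \<inter> ?f -` S"
    by (auto simp: line_in_proj_space density_map_line)
  moreover have "open (- {0} \<inter> ?f -` S)"
    by (rule continuous_open_preimage[OF smooth_on_continuous[OF smooth_on_to_q3_ketbra] _ \<open>open S\<close>]) auto
  ultimately show "openin proj_topology {L \<in> topspace proj_topology. density_map L \<in> S}"
    by (simp add: openin_proj_topology)
qed simp

lemma compact_space_proj_topology: "compact_space proj_topology"
proof -
  have "compactin (top_of_set (- {0})) (sphere (0 :: complex ^ 3) 1)"
    by (auto simp: compactin_subtopology)
  then have "compactin proj_topology (line ` sphere (0 :: complex ^ 3) 1)"
    by (rule image_compactin[OF _ continuous_map_line])
  moreover have "line ` sphere (0 :: complex ^ 3) 1 = proj_space"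
  proof (intro equalityI subsetI)
    fix L assume "L \<in> line ` sphere (0 :: complex ^ 3) 1"
    then show "L \<in> proj_space" by (auto intro!: line_in_proj_space)
  next
    fix L assume "L \<in> proj_space"
    then show "L \<in> line ` sphere (0 :: complex ^ 3) 1" by (rule proj_space_unitE) auto
  qed
  ultimately show ?thesis by (simp add: compact_space_def)
qed

text \<open>A continuous injection of a compact space into a Hausdorff space is an embedding.
  Hausdorffness and second countability of the quotient topology are then inherited from the
  image.\<close>

lemma embedding_map_density_map: "embedding_map proj_topology euclidean density_map"
  using continuous_imp_embedding_map[OF continuous_map_density_map compact_space_proj_topology]
    inj_on_density_map by (simp add: Hausdorff_space_euclidean)

lemma homeomorphic_map_density_map: "homeomorphic_map proj_topology (top_of_set state_variety) density_map"
  using embedding_map_density_map by (simp add: embedding_map_def density_map_image)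

lemma second_countable_euclidean: "second_countable (euclidean :: 'a::second_countable_topology topology)"
proof -
  obtain B :: "'a set set" where B: "countable B" "topological_basis B"
    using ex_countable_basis by blast
  have "\<exists>V\<in>B. x \<in> V \<and> V \<subseteq> U" if "open U" "x \<in> U" for U x
    using topological_basisE[OF B(2) that] by metis
  then show ?thesis
    unfolding second_countable_def using B(1) topological_basis_open[OF B(2)]
    by (intro exI[of _ B]) auto
qed

lemma Hausdorff_proj_topology: "Hausdorff_space proj_topology"
  using homeomorphic_Hausdorff_space[OF homeomorphic_map_imp_homeomorphic_space[OF homeomorphic_map_density_map]]
  by (simp add: Hausdorff_space_subtopology Hausdorff_space_euclidean)

lemma second_countable_proj_topology: "second_countable proj_topology"
  using homeomorphic_space_second_countability[OF homeomorphic_map_imp_homeomorphic_space[OF homeomorphic_map_density_map]]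
  by (simp add: second_countable_subtopology second_countable_euclidean)

lemma compact_state_variety: "compact state_variety"
  using image_compactin[OF _ continuous_map_density_map] compact_space_proj_topology
  unfolding compact_space_def by (simp flip: density_map_image)


section \<open>Affine charts and the Fubini-Study metric\<close>

text \<open>The positions at which \<open>affine_lift i\<close> puts the coordinates \<open>z $ 1\<close> and \<open>z $ 2\<close>.\<close>

definition idx1 :: "3 \<Rightarrow> 3" where "idx1 i = (if i = 1 then 2 else 1)"
definition idx2 :: "3 \<Rightarrow> 3" where "idx2 i = (if i = 3 then 2 else 3)"

lemma idx_distinct [simp]:
  "idx1 i \<noteq> i" "idx2 i \<noteq> i" "idx1 i \<noteq> idx2 i" "i \<noteq> idx1 i" "i \<noteq> idx2 i" "idx2 i \<noteq> idx1 i"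
  using exhaust_3[of i] by (auto simp: idx1_def idx2_def)

lemma UNIV_idx: "UNIV = {i, idx1 i, idx2 i}"
  using exhaust_3[of i] UNIV_3 by (auto simp: idx1_def idx2_def)

lemma forall_idx: "(\<forall>j. P j) \<longleftrightarrow> P i \<and> P (idx1 i) \<and> P (idx2 i)"
  using UNIV_idx[of i] by (metis UNIV_I empty_iff insert_iff)

lemma sum_idx: "sum f UNIV = f i + f (idx1 i) + f (idx2 i)"
  by (subst UNIV_idx[of i]) (simp add: add.assoc)

lemma affine_lift_nth [simp]:
  "affine_lift i z $ i = 1" "affine_lift i z $ idx1 i = z $ 1" "affine_lift i z $ idx2 i = z $ 2"
  using exhaust_3[of i] by (auto simp: affine_lift_def idx1_def idx2_def)

lemma affine_lift_nonzero [simp]: "affine_lift i z \<noteq> 0"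
  using affine_lift_nth(1)[of i z] by (metis zero_index zero_neq_one)

definition affine_coord :: "3 \<Rightarrow> complex ^ 3 \<Rightarrow> complex ^ 2" where
  "affine_coord i v = vector [v $ idx1 i / v $ i, v $ idx2 i / v $ i]"

lemma affine_lift_coord: "v $ i \<noteq> 0 \<Longrightarrow> v = v $ i *s affine_lift i (affine_coord i v)"
  by (simp add: vec_eq_iff forall_idx[of _ i] affine_coord_def)

lemma affine_coord_smult_lift: "c \<noteq> 0 \<Longrightarrow> affine_coord i (c *s affine_lift i z) = z"
  by (simp add: affine_coord_def vec_eq_iff forall_2)

lemma affine_chart_domain: "line v \<in> fst (affine_chart i) \<longleftrightarrow> v $ i \<noteq> 0"
proof
  assume "v $ i \<noteq> 0"
  moreover then have "v \<noteq> 0" by auto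
  moreover have "v \<in> line v" by (metis mem_line vector_smult_lid)
  ultimately show "line v \<in> fst (affine_chart i)"
    by (auto simp: affine_chart_def line_in_proj_space)
qed (auto simp: affine_chart_def mem_line)

lemma affine_chart_line:
  assumes "v $ i \<noteq> 0"
  shows "snd (affine_chart i) (line v) = affine_coord i v"
proof -
  have "(THE z. affine_lift i z \<in> line v) = affine_coord i v"
  proof (rule the_equality)
    have "affine_lift i (affine_coord i v) = (1 / v $ i) *s v"
      using assms by (simp add: vec_eq_iff forall_idx[of _ i] affine_coord_def)
    then show "affine_lift i (affine_coord i v) \<in> line v" by (auto simp: mem_line)
    fix z assume "affine_lift i z \<in> line v"
    then obtain c where c: "affine_lift i z = c *s v" by (auto simp: mem_line)
    then have "c * v $ i = 1" using affine_lift_nth(1)[of i z] by simp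
    then have "c \<noteq> 0" by auto
    then have "v = (1 / c) *s affine_lift i z" unfolding c by (simp add: vector_smult_assoc)
    then show "z = affine_coord i v" using affine_coord_smult_lift[of "1 / c" i z] \<open>c \<noteq> 0\<close> by simp
  qed
  then show ?thesis by (simp add: affine_chart_def)
qed

lemma line_affine_lift_mem: "line (affine_lift i z) \<in> fst (affine_chart i)"
  by (simp add: affine_chart_domain)

lemma affine_chart_lift: "snd (affine_chart i) (line (affine_lift i z)) = z"
  using affine_coord_smult_lift[of 1 i z] by (simp add: affine_chart_line)

lemma affine_chart_memE:
  assumes "L \<in> fst (affine_chart i)"
  obtains z where "L = line (affine_lift i z)"
proof -
  have "L \<in> proj_space" using assms by (simp add: affine_chart_def)
  then obtain v where v: "v \<noteq> 0" "L = line v" by (rule proj_spaceE)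
  then have "v $ i \<noteq> 0" using assms affine_chart_domain by blast
  then have "L = line (affine_lift i (affine_coord i v))"
    using line_smult affine_lift_coord v(2) by metis
  then show ?thesis by (rule that)
qed

lemma affine_chart_image: "snd (affine_chart i) ` fst (affine_chart i) = UNIV"
proof -
  have "z \<in> snd (affine_chart i) ` fst (affine_chart i)" for z
    by (rule image_eqI[where x = "line (affine_lift i z)"]) (simp_all add: affine_chart_lift line_affine_lift_mem)
  then show ?thesis by blast
qed

lemma inj_on_affine_chart: "inj_on (snd (affine_chart i)) (fst (affine_chart i))"
proof (rule inj_onI)
  fix L M assume *: "L \<in> fst (affine_chart i)" "M \<in> fst (affine_chart i)"
    "snd (affine_chart i) L = snd (affine_chart i) M"
  obtain z where z: "L = line (affine_lift i z)" using *(1) by (rule affine_chart_memE)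
  obtain w where w: "M = line (affine_lift i w)" using *(2) by (rule affine_chart_memE)
  show "L = M" using *(3) by (simp add: z w affine_chart_lift)
qed

lemma inv_affine_chart: "inv_into (fst (affine_chart i)) (snd (affine_chart i)) z = line (affine_lift i z)"
  by (rule inv_into_f_eq[OF inj_on_affine_chart line_affine_lift_mem affine_chart_lift])

lemma smooth_on_vec_idx:
  fixes f :: "'a::real_normed_vector \<Rightarrow> 'b::euclidean_space ^ 3"
  assumes "open S" "smooth_on S (\<lambda>x. f x $ i)" "smooth_on S (\<lambda>x. f x $ idx1 i)" "smooth_on S (\<lambda>x. f x $ idx2 i)"
  shows "smooth_on S f"
proof (rule smooth_on_vec[OF assms(1)])
  show "smooth_on S (\<lambda>x. f x $ j)" for j
    using UNIV_idx[of i] assms by (metis UNIV_I empty_iff insert_iff)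
qed

lemma smooth_on_ident: "smooth_on (S :: 'a::euclidean_space set) (\<lambda>x. x)"
  by (rule smooth_on_linear[OF linear_id[unfolded id_def]])

lemma smooth_on_affine_lift: "smooth_on UNIV (affine_lift i)"
  by (rule smooth_on_vec_idx[where i = i])
    (auto intro!: smooth_on_const smooth_on_nth smooth_on_ident)

lemma density_map_affine_lift:
  "(density_map \<circ> inv_into (fst (affine_chart i)) (snd (affine_chart i))) =
    (\<lambda>z. to_q3 (inverse ((norm (affine_lift i z))\<^sup>2) *\<^sub>R ketbra (affine_lift i z)))"
  by (simp add: fun_eq_iff inv_affine_chart density_map_line)

text \<open>On the image of the density map the diagonal entry is the squared modulus of the
  \<open>i\<close>-th component of a unit vector, so this open set cuts out the affine chart domain.
  It also serves as the ambient domain of the slice chart.\<close>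

definition q3_domain :: "3 \<Rightarrow> q3 set" where
  "q3_domain i = {y. 0 < Re (of_q3 y $ i $ i)}"

text \<open>
  On the image of the density map these are the affine coordinates, because
  \<open>\<psi>\<^sub>j cnj \<psi>\<^sub>i / |\<psi>\<^sub>i|\<^sup>2 = \<psi>\<^sub>j / \<psi>\<^sub>i\<close>.
\<close>

definition q3_coord1 :: "3 \<Rightarrow> q3 \<Rightarrow> complex" where
  "q3_coord1 i y = inverse (Re (of_q3 y $ i $ i)) *\<^sub>R of_q3 y $ idx1 i $ i"

definition q3_coord2 :: "3 \<Rightarrow> q3 \<Rightarrow> complex" where
  "q3_coord2 i y = inverse (Re (of_q3 y $ i $ i)) *\<^sub>R of_q3 y $ idx2 i $ i"

lemma smooth_on_of_q3_nth: "smooth_on S (\<lambda>y. of_q3 y $ a $ b)"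
  using smooth_on_nth[OF open_UNIV smooth_on_nth[OF open_UNIV smooth_on_of_q3]] smooth_on_subset subset_UNIV by blast

lemma smooth_on_Re: "open S \<Longrightarrow> smooth_on S f \<Longrightarrow> smooth_on S (\<lambda>x. Re (f x))"
  by (rule smooth_on_linear_compose[OF _ bounded_linear.linear[OF bounded_linear_Re]])

lemma smooth_on_Im: "open S \<Longrightarrow> smooth_on S f \<Longrightarrow> smooth_on S (\<lambda>x. Im (f x))"
  by (rule smooth_on_linear_compose[OF _ bounded_linear.linear[OF bounded_linear_Im]])

lemma smooth_on_cnj: "open S \<Longrightarrow> smooth_on S f \<Longrightarrow> smooth_on S (\<lambda>x. cnj (f x))"
  by (rule smooth_on_linear_compose[OF _ bounded_linear.linear[OF bounded_linear_cnj]])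

lemma smooth_on_of_real: "open S \<Longrightarrow> smooth_on S f \<Longrightarrow> smooth_on S (\<lambda>x. complex_of_real (f x))"
  by (rule smooth_on_linear_compose[OF _ bounded_linear.linear[OF bounded_linear_of_real]])

lemma open_q3_domain: "open (q3_domain i)"
proof -
  have "continuous_on UNIV (\<lambda>y. Re (of_q3 y $ i $ i))"
    by (intro smooth_on_continuous smooth_on_Re smooth_on_of_q3_nth open_UNIV)
  then have "open ((\<lambda>y. Re (of_q3 y $ i $ i)) -` {0<..})" by (rule open_vimage[OF open_greaterThan])
  then show ?thesis by (simp add: q3_domain_def vimage_def)
qed

lemma smooth_on_q3_coord:
  "smooth_on (q3_domain i) (q3_coord1 i)" "smooth_on (q3_domain i) (q3_coord2 i)"
  unfolding q3_coord1_def q3_coord2_def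
  by (intro smooth_on_scaleR smooth_on_inverse smooth_on_Re smooth_on_of_q3_nth open_q3_domain; simp add: q3_domain_def)+

lemma density_map_mem_domain:
  assumes "v \<noteq> 0"
  shows "density_map (line v) \<in> q3_domain i \<longleftrightarrow> v $ i \<noteq> 0"
proof -
  have "Re (v $ i * cnj (v $ i)) = (cmod (v $ i))\<^sup>2" by (simp only: complex_norm_square[symmetric] Re_complex_of_real)
  then show ?thesis
    using assms by (simp add: q3_domain_def of_q3_density_map ketbra_def zero_less_mult_iff)
qed

lemma q3_coord_density_map:
  assumes "v $ i \<noteq> 0"
  shows "q3_coord1 i (density_map (line v)) = v $ idx1 i / v $ i"
    "q3_coord2 i (density_map (line v)) = v $ idx2 i / v $ i"
proof -
  have v: "v \<noteq> 0" using assms by auto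
  have Re: "Re (v $ i * cnj (v $ i)) = (cmod (v $ i))\<^sup>2" by (simp only: complex_norm_square[symmetric] Re_complex_of_real)
  have *: "(inverse ((cmod (v $ i))\<^sup>2)) *\<^sub>R (a * cnj (v $ i)) = a / v $ i" for a
    using assms by (simp add: scaleR_conv_of_real field_simps complex_norm_square del: of_real_power)
  have "inverse (inverse r * q) * inverse r = inverse q" if "r \<noteq> 0" for r q :: real
    using that by (simp add: field_simps)
  then have "inverse (inverse ((norm v)\<^sup>2) * (cmod (v $ i))\<^sup>2) *\<^sub>R inverse ((norm v)\<^sup>2) *\<^sub>R (a * cnj (v $ i)) = a / v $ i" for a
    using v unfolding scaleR_scaleR by (metis * norm_eq_zero zero_eq_power2)
  then show "q3_coord1 i (density_map (line v)) = v $ idx1 i / v $ i"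
    "q3_coord2 i (density_map (line v)) = v $ idx2 i / v $ i"
    using v Re by (simp_all add: q3_coord1_def q3_coord2_def of_q3_density_map ketbra_def)
qed

lemma embedded_chart_affine: "embedded_chart density_map proj_space (affine_chart i)"
  unfolding embedded_chart_def
proof (intro conjI exI[of _ "q3_domain i"] exI[of _ "\<lambda>y. vector [q3_coord1 i y, q3_coord2 i y] :: complex ^ 2"] ballI)
  show "open (snd (affine_chart i) ` fst (affine_chart i))" by (simp add: affine_chart_image)
  show "smooth_on (snd (affine_chart i) ` fst (affine_chart i)) (density_map \<circ> inv_into (fst (affine_chart i)) (snd (affine_chart i)))"
    unfolding affine_chart_image density_map_affine_lift power2_norm_eq_inner
    by (intro smooth_on_to_q3 smooth_on_scaleR smooth_on_ketbra smooth_on_inverse smooth_on_inner smooth_on_affine_lift open_UNIV) simp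
  show "smooth_on (q3_domain i) (\<lambda>y. vector [q3_coord1 i y, q3_coord2 i y] :: complex ^ 2)"
  proof (rule smooth_on_vec[OF open_q3_domain])
    show "smooth_on (q3_domain i) (\<lambda>y. (vector [q3_coord1 i y, q3_coord2 i y] :: complex ^ 2) $ j)" for j
      using exhaust_2[of j] smooth_on_q3_coord[of i] by auto
  qed
  show "fst (affine_chart i) = {p \<in> proj_space. density_map p \<in> q3_domain i}"
  proof (intro equalityI subsetI)
    fix L assume "L \<in> fst (affine_chart i)"
    then show "L \<in> {p \<in> proj_space. density_map p \<in> q3_domain i}"
      by (rule affine_chart_memE) (simp add: line_in_proj_space density_map_mem_domain)
  next
    fix L assume L: "L \<in> {p \<in> proj_space. density_map p \<in> q3_domain i}"
    then obtain v where "v \<noteq> 0" "L = line v" using proj_spaceE by (metis mem_Collect_eq)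
    then show "L \<in> fst (affine_chart i)" using L by (simp add: affine_chart_domain density_map_mem_domain)
  qed
  fix L assume "L \<in> fst (affine_chart i)"
  then obtain z where "L = line (affine_lift i z)" by (rule affine_chart_memE)
  then show "vector [q3_coord1 i (density_map L), q3_coord2 i (density_map L)] = snd (affine_chart i) L"
    by (simp add: q3_coord_density_map affine_chart_lift vec_eq_iff forall_2)
qed (simp add: open_q3_domain inj_on_affine_chart)+

lemma affine_charts_cover: "(\<Union>c\<in>proj_atlas. fst c) = proj_space"
proof (intro equalityI subsetI)
  fix L assume "L \<in> proj_space"
  then obtain v where v: "v \<noteq> 0" "L = line v" by (rule proj_spaceE)
  then obtain i where "v $ i \<noteq> 0" by (auto simp: vec_eq_iff)
  then show "L \<in> (\<Union>c\<in>proj_atlas. fst c)" using v affine_chart_domain by (auto simp: proj_atlas_def)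
qed (auto simp: proj_atlas_def affine_chart_def)

lemma embedded_chart_proj_atlas: "c \<in> proj_atlas \<Longrightarrow> embedded_chart density_map proj_space c"
  using embedded_chart_affine by (auto simp only: proj_atlas_def)

lemma smooth_manifold_proj: "smooth_manifold proj_topology proj_atlas"
  unfolding smooth_manifold_def
  using Hausdorff_proj_topology second_countable_proj_topology
    smooth_atlas_embedded[OF embedded_chart_proj_atlas topspace_proj_topology embedding_map_density_map affine_charts_cover]
  by blast

text \<open>
  The right-hand side does not involve the section \<open>\<psi>\<close>: near \<open>p\<close> the map \<open>|\<psi>\<rangle>\<langle>\<psi>|\<close> is the density map in
  the chart.  Hence all sections yield the same value in the definition of \<open>fubini_study\<close>.
\<close>

lemma fubini_study_section:
  assumes p: "p \<in> fst c" and c: "c = affine_chart i"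
    and V: "open V" "snd c p \<in> V" "smooth_on V \<psi>"
    and \<psi>: "\<And>z. z \<in> V \<Longrightarrow> norm (\<psi> z) = 1 \<and> \<psi> z \<in> inv_into (fst c) (snd c) z"
  shows "3 * fs_form (\<psi> (snd c p)) (frechet_derivative \<psi> (at (snd c p)) u) (frechet_derivative \<psi> (at (snd c p)) v) =
    param_deriv density_map c p u \<bullet> param_deriv density_map c p v"
proof -
  let ?x = "snd c p" and ?D = "frechet_derivative \<psi> (at (snd c p))"
  have D: "(\<psi> has_derivative ?D) (at ?x)" using smooth_on_has_derivative[OF V(3,2)] .
  have eq: "to_q3 (ketbra (\<psi> z)) = (density_map \<circ> inv_into (fst c) (snd c)) z" if "z \<in> V" for z
  proof -
    have n: "norm (\<psi> z) = 1" "\<psi> z \<in> line (affine_lift i z)" using \<psi>[OF that] by (auto simp: c inv_affine_chart)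
    then have "\<psi> z \<noteq> 0" by auto
    then have "line (\<psi> z) = line (affine_lift i z)" using line_eqI n(2) by blast
    then show ?thesis using density_map_unit[OF n(1)] by (simp add: c inv_affine_chart)
  qed
  have "((density_map \<circ> inv_into (fst c) (snd c)) has_derivative
      (\<lambda>u. bloch_vec (ket_bra (\<psi> ?x) (?D u) + ket_bra (?D u) (\<psi> ?x)))) (at ?x)"
    by (rule has_derivative_transform_within_open[OF to_q3_ketbra_has_derivative[OF D] V(1,2) eq])
  moreover have "((density_map \<circ> inv_into (fst c) (snd c)) has_derivative param_deriv density_map c p) (at ?x)"
    using param_deriv_has_derivative[OF embedded_chart_affine p[unfolded c]] unfolding c .
  ultimately have P: "param_deriv density_map c p = (\<lambda>u. bloch_vec (ket_bra (\<psi> ?x) (?D u) + ket_bra (?D u) (\<psi> ?x)))"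
    by (rule has_derivative_unique[symmetric])
  have "Re (braket (\<psi> ?x) (?D u)) = 0" for u
    by (rule unit_section_orthogonal[OF D V(1,2)]) (simp add: \<psi>)
  then show ?thesis unfolding P using \<psi>[OF V(2)] by (simp add: inner_bloch_vec_ket_bra)
qed

text \<open>The description in \<open>fubini_study\<close> needs a section to exist, here the
  normalised affine lift, and all sections to agree, which \<open>fubini_study_section\<close>
  provides.\<close>

lemma fubini_study_affine_chart:
  assumes c: "c \<in> proj_atlas" and p: "p \<in> fst c"
  shows "fubini_study c p u v = pullback_metric (1 / 3) density_map c p u v"
proof -
  obtain i where i: "c = affine_chart i" using c by (auto simp: proj_atlas_def)
  \<comment> \<open>The inverse norm is written as a real power of the positive squared norm, so
    that the power rule gives smoothness.\<close>
  define \<psi> where "\<psi> = (\<lambda>z. ((affine_lift i z \<bullet> affine_lift i z) powr (- 1 / 2)) *\<^sub>R affine_lift i z)"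
  have pos: "0 < affine_lift i z \<bullet> affine_lift i z" for z by simp
  have sm: "smooth_on UNIV \<psi>"
    unfolding \<psi>_def using pos
    by (intro smooth_on_scaleR smooth_on_powr smooth_on_inner smooth_on_affine_lift open_UNIV)
  have \<psi>: "norm (\<psi> z) = 1 \<and> \<psi> z \<in> inv_into (fst c) (snd c) z" for z
  proof
    have "(affine_lift i z \<bullet> affine_lift i z) powr (- 1 / 2) = inverse (norm (affine_lift i z))"
      by (simp add: powr_minus powr_half_sqrt norm_eq_sqrt_inner)
    then show "norm (\<psi> z) = 1" by (simp add: \<psi>_def)
    have "a *\<^sub>R v = of_real a *s v" for a and v :: "complex ^ 3"
      unfolding vec_eq_iff vector_scaleR_component vector_smult_component by (simp add: scaleR_conv_of_real)
    then show "\<psi> z \<in> inv_into (fst c) (snd c) z"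
      unfolding i inv_affine_chart mem_line \<psi>_def by metis
  qed
  show ?thesis
    unfolding fubini_study_def
  proof (rule the_equality)
    show "\<exists>V \<psi>. open V \<and> snd c p \<in> V \<and> V \<subseteq> snd c ` fst c \<and> smooth_on V \<psi> \<and>
       (\<forall>z\<in>V. norm (\<psi> z) = 1 \<and> \<psi> z \<in> inv_into (fst c) (snd c) z) \<and>
       pullback_metric (1 / 3) density_map c p u v =
         fs_form (\<psi> (snd c p)) (frechet_derivative \<psi> (at (snd c p)) u) (frechet_derivative \<psi> (at (snd c p)) v)"
    proof (intro exI[of _ UNIV] exI[of _ \<psi>] conjI ballI)
      show "pullback_metric (1 / 3) density_map c p u v =
         fs_form (\<psi> (snd c p)) (frechet_derivative \<psi> (at (snd c p)) u) (frechet_derivative \<psi> (at (snd c p)) v)"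
        using fubini_study_section[OF p i open_UNIV UNIV_I sm \<psi>, of u v] by (simp add: pullback_metric_def)
    qed (use sm \<psi> in \<open>auto simp: i affine_chart_image\<close>)
  next
    fix r
    assume "\<exists>V \<psi>. open V \<and> snd c p \<in> V \<and> V \<subseteq> snd c ` fst c \<and> smooth_on V \<psi> \<and>
       (\<forall>z\<in>V. norm (\<psi> z) = 1 \<and> \<psi> z \<in> inv_into (fst c) (snd c) z) \<and>
       r = fs_form (\<psi> (snd c p)) (frechet_derivative \<psi> (at (snd c p)) u) (frechet_derivative \<psi> (at (snd c p)) v)"
    then obtain V \<phi> where "open V" "snd c p \<in> V" "smooth_on V \<phi>"
      "\<And>z. z \<in> V \<Longrightarrow> norm (\<phi> z) = 1 \<and> \<phi> z \<in> inv_into (fst c) (snd c) z"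
      "r = fs_form (\<phi> (snd c p)) (frechet_derivative \<phi> (at (snd c p)) u) (frechet_derivative \<phi> (at (snd c p)) v)"
      by blast
    then show "r = pullback_metric (1 / 3) density_map c p u v"
      using fubini_study_section[OF p i, of V \<phi> u v] by (simp add: pullback_metric_def)
  qed
qed


section \<open>Slice charts of the variety\<close>

lemma q3_coeff_sum_eps: "m < 8 \<Longrightarrow> q3_coeff (\<Sum>n<8. f n *\<^sub>R eps ^ n) m = f m"
proof -
  assume m: "m < 8"
  have "q3_coeff (\<Sum>n<8. f n *\<^sub>R eps ^ n) m = (\<Sum>n<8. f n * q3_coeff (eps ^ n) m)" by simp
  also have "\<dots> = (\<Sum>n<8. if n = m then f n else 0)"
    using m by (intro sum.cong) (auto simp: q3_coeff_eps_power)
  finally show ?thesis using m by simp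
qed

definition enc :: "real list \<Rightarrow> q3" where
  "enc xs = (\<Sum>n<8. (xs ! n) *\<^sub>R eps ^ n)"

lemma q3_coeff_enc [simp]: "m < 8 \<Longrightarrow> q3_coeff (enc xs) m = xs ! m"
  unfolding enc_def by (rule q3_coeff_sum_eps)

lemma less_8_cases: "(\<forall>n<8. P n) \<longleftrightarrow> P 0 \<and> P 1 \<and> P 2 \<and> P 3 \<and> P 4 \<and> P 5 \<and> P 6 \<and> P (7 :: nat)"
proof -
  have "{..<8::nat} = {0, 1, 2, 3, 4, 5, 6, 7}" by auto
  then have "(\<forall>n\<in>{..<8}. P n) \<longleftrightarrow> (\<forall>n\<in>{0, 1, 2, 3, 4, 5, 6, 7}. P n)" by (rule arg_cong)
  moreover have "(\<forall>n<8. P n) \<longleftrightarrow> (\<forall>n\<in>{..<8}. P n)" by auto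
  ultimately show ?thesis by simp
qed

lemma smooth_on_q3I:
  assumes "open S" "\<forall>n<8. smooth_on S (\<lambda>x. q3_coeff (f x) n)"
  shows "smooth_on S f"
proof -
  have "smooth_on S (\<lambda>x. \<Sum>n<8. q3_coeff (f x) n *\<^sub>R eps ^ n)"
    by (rule smooth_on_sum[OF assms(1)]) (intro smooth_on_scaleR smooth_on_const assms(1), use assms(2) in auto)
  moreover have "(\<Sum>n<8. q3_coeff (f x) n *\<^sub>R eps ^ n) = f x" for x
    by (rule q3_eqI) (rule q3_coeff_sum_eps)
  ultimately show ?thesis by simp
qed

text \<open>The Hermitian matrix of trace one whose column \<open>i\<close> is \<open>r\<close>
  times the affine vector with coordinates \<open>z1\<close>, \<open>z2\<close>; the last diagonal
  entry is forced by the trace.\<close>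

definition slice_mat :: "3 \<Rightarrow> complex \<Rightarrow> complex \<Rightarrow> real \<Rightarrow> real \<Rightarrow> complex \<Rightarrow> complex ^ 3 ^ 3" where
  "slice_mat i z1 z2 r t q = (\<chi> a b.
     if a = i then (if b = i then of_real r else if b = idx1 i then r *\<^sub>R cnj z1 else r *\<^sub>R cnj z2)
     else if a = idx1 i then (if b = i then r *\<^sub>R z1 else if b = idx1 i then of_real t else cnj q)
     else (if b = i then r *\<^sub>R z2 else if b = idx1 i then q else of_real (1 - r - t)))"

lemma slice_mat_nth [simp]:
  "slice_mat i z1 z2 r t q $ i $ i = of_real r"
  "slice_mat i z1 z2 r t q $ i $ idx1 i = r *\<^sub>R cnj z1"
  "slice_mat i z1 z2 r t q $ i $ idx2 i = r *\<^sub>R cnj z2"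
  "slice_mat i z1 z2 r t q $ idx1 i $ i = r *\<^sub>R z1"
  "slice_mat i z1 z2 r t q $ idx1 i $ idx1 i = of_real t"
  "slice_mat i z1 z2 r t q $ idx1 i $ idx2 i = cnj q"
  "slice_mat i z1 z2 r t q $ idx2 i $ i = r *\<^sub>R z2"
  "slice_mat i z1 z2 r t q $ idx2 i $ idx1 i = q"
  "slice_mat i z1 z2 r t q $ idx2 i $ idx2 i = of_real (1 - r - t)"
  by (simp_all add: slice_mat_def)

lemma hermitian_slice_mat: "hermitian (slice_mat i z1 z2 r t q)"
  by (simp add: hermitian_def forall_idx[of _ i] del: of_real_diff)

lemma trace_slice_mat: "trace (slice_mat i z1 z2 r t q) = 1"
  by (simp add: trace_def sum_idx[of _ i])

lemma hermitian_eq_slice_mat: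
  assumes "hermitian A" "trace A = 1" "0 < Re (A $ i $ i)"
  shows "A = slice_mat i (inverse (Re (A $ i $ i)) *\<^sub>R A $ idx1 i $ i) (inverse (Re (A $ i $ i)) *\<^sub>R A $ idx2 i $ i)
    (Re (A $ i $ i)) (Re (A $ idx1 i $ idx1 i)) (A $ idx2 i $ idx1 i)"
proof -
  have h: "cnj (A $ a $ b) = A $ b $ a" for a b using assms(1) by (simp add: hermitian_def)
  have d: "A $ a $ a = of_real (Re (A $ a $ a))" for a
    using h[of a a] by (simp add: complex_eq_iff)
  have "A $ i $ i + A $ idx1 i $ idx1 i + A $ idx2 i $ idx2 i = 1"
    using assms(2) by (simp add: trace_def sum_idx[of _ i])
  then have "A $ idx2 i $ idx2 i = 1 - A $ i $ i - A $ idx1 i $ idx1 i" by (simp add: algebra_simps)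
  then show ?thesis
    using assms(3) d[of i] d[of "idx1 i"] by (simp add: vec_eq_iff[of A] vec_eq_iff[of "A $ _"] forall_idx[of _ i] h)
qed

text \<open>
  The squared modulus of the \<open>i\<close>-th component of a unit vector with affine coordinates \<open>z1\<close>, \<open>z2\<close>.
\<close>

definition fs_weight :: "complex \<Rightarrow> complex \<Rightarrow> real" where
  "fs_weight z1 z2 = inverse (1 + z1 \<bullet> z1 + z2 \<bullet> z2)"

lemma fs_weight_pos: "0 < 1 + z1 \<bullet> z1 + z2 \<bullet> (z2 :: complex)"
  by (intro add_pos_nonneg) auto

lemma smooth_on_fs_weight:
  "open S \<Longrightarrow> smooth_on S f \<Longrightarrow> smooth_on S g \<Longrightarrow> smooth_on S (\<lambda>x. fs_weight (f x) (g x))"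
  unfolding fs_weight_def
  by (intro smooth_on_inverse smooth_on_add smooth_on_inner smooth_on_const fs_weight_pos)

text \<open>
  Coordinates in which the variety is flat: the affine coordinates, followed by the deviations of the
  remaining matrix entries from their values on the variety.  The inverse exists because a
  trace-one Hermitian matrix \<open>A\<close> is determined by \<open>A\<^sub>i\<^sub>i\<close>, \<open>A\<^sub>j\<^sub>j\<close>, \<open>A\<^sub>k\<^sub>j\<close> and the quotients \<open>A\<^sub>j\<^sub>i / A\<^sub>i\<^sub>i\<close>,
  \<open>A\<^sub>k\<^sub>i / A\<^sub>i\<^sub>i\<close>.
\<close>

definition flatten :: "3 \<Rightarrow> q3 \<Rightarrow> q3" where
  "flatten i x = (let z1 = q3_coord1 i x; z2 = q3_coord2 i x; s = fs_weight z1 z2; A = of_q3 x;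
      w = A $ idx2 i $ idx1 i - s *\<^sub>R (z2 * cnj z1)
    in enc [Re z1, Im z1, Re z2, Im z2, Re (A $ i $ i) - s, Re (A $ idx1 i $ idx1 i) - s * (z1 \<bullet> z1), Re w, Im w])"

definition dec1 :: "q3 \<Rightarrow> complex" where "dec1 y = Complex (q3_coeff y 0) (q3_coeff y 1)"
definition dec2 :: "q3 \<Rightarrow> complex" where "dec2 y = Complex (q3_coeff y 2) (q3_coeff y 3)"
definition dec3 :: "q3 \<Rightarrow> complex" where "dec3 y = Complex (q3_coeff y 6) (q3_coeff y 7)"

definition unflatten :: "3 \<Rightarrow> q3 \<Rightarrow> q3" where
  "unflatten i y = (let z1 = dec1 y; z2 = dec2 y; s = fs_weight z1 z2
    in to_q3 (slice_mat i z1 z2 (q3_coeff y 4 + s) (q3_coeff y 5 + s * (z1 \<bullet> z1)) (dec3 y + s *\<^sub>R (z2 * cnj z1))))"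

text \<open>The left summand is the deviation of the \<open>(i, i)\<close> entry, so the condition
  says that the entry of the rebuilt matrix is positive. It is the same set for every
  \<open>i\<close>.\<close>

definition flat_domain :: "q3 set" where
  "flat_domain = {y. 0 < q3_coeff y 4 + fs_weight (dec1 y) (dec2 y)}"

lemma dec_enc:
  "dec1 (enc [a, b, c, d, e, f, g, h]) = Complex a b"
  "dec2 (enc [a, b, c, d, e, f, g, h]) = Complex c d"
  "dec3 (enc [a, b, c, d, e, f, g, h]) = Complex g h"
  by (simp_all add: dec1_def dec2_def dec3_def)

lemma flatten_domain:
  assumes "x \<in> q3_domain i"
  shows "flatten i x \<in> flat_domain" "unflatten i (flatten i x) = x"
proof -
  show "flatten i x \<in> flat_domain"
    using assms by (simp add: flatten_def Let_def flat_domain_def dec_enc q3_domain_def complex_surj)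
  have "of_q3 x = slice_mat i (q3_coord1 i x) (q3_coord2 i x) (Re (of_q3 x $ i $ i)) (Re (of_q3 x $ idx1 i $ idx1 i)) (of_q3 x $ idx2 i $ idx1 i)"
    unfolding q3_coord1_def q3_coord2_def
    by (rule hermitian_eq_slice_mat[OF hermitian_of_q3 trace_of_q3]) (use assms in \<open>simp add: q3_domain_def\<close>)
  then have "to_q3 (slice_mat i (q3_coord1 i x) (q3_coord2 i x) (Re (of_q3 x $ i $ i)) (Re (of_q3 x $ idx1 i $ idx1 i)) (of_q3 x $ idx2 i $ idx1 i)) = x"
    by (metis to_q3_of_q3)
  then show "unflatten i (flatten i x) = x"
    by (simp add: flatten_def unflatten_def Let_def dec_enc complex_surj del: minus_complex.simps scaleR_complex.simps)
qed

lemma unflatten_domain: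
  assumes "y \<in> flat_domain"
  shows "unflatten i y \<in> q3_domain i" "flatten i (unflatten i y) = y"
proof -
  let ?s = "fs_weight (dec1 y) (dec2 y)"
  let ?B = "slice_mat i (dec1 y) (dec2 y) (q3_coeff y 4 + ?s) (q3_coeff y 5 + ?s * (dec1 y \<bullet> dec1 y)) (dec3 y + ?s *\<^sub>R (dec2 y * cnj (dec1 y)))"
  have B: "of_q3 (unflatten i y) = ?B"
    by (simp add: unflatten_def Let_def of_q3_to_q3 hermitian_slice_mat trace_slice_mat)
  have pos: "0 < q3_coeff y 4 + ?s" using assms by (simp add: flat_domain_def)
  then show "unflatten i y \<in> q3_domain i" by (simp add: q3_domain_def B)
  have z: "q3_coord1 i (unflatten i y) = dec1 y" "q3_coord2 i (unflatten i y) = dec2 y"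
    using pos by (simp_all add: q3_coord1_def q3_coord2_def B)
  have "\<forall>n<8. q3_coeff (flatten i (unflatten i y)) n = q3_coeff y n"
    unfolding less_8_cases flatten_def Let_def z B by (simp add: dec1_def dec2_def dec3_def)
  then show "flatten i (unflatten i y) = y" by (intro q3_eqI) auto
qed

lemma smooth_on_coeff: "smooth_on S (\<lambda>y. q3_coeff y n)"
  by (rule smooth_on_linear[OF linear_q3_coeff])

lemma smooth_on_dec: "smooth_on S dec1" "smooth_on S dec2" "smooth_on S dec3"
  by (rule smooth_on_linear, rule linearI; simp add: dec1_def dec2_def dec3_def complex_eq_iff)+

lemma open_flat_domain: "open flat_domain"
proof -
  have "continuous_on UNIV (\<lambda>y. q3_coeff y 4 + fs_weight (dec1 y) (dec2 y))"
    by (intro smooth_on_continuous smooth_on_add smooth_on_coeff smooth_on_fs_weight smooth_on_dec open_UNIV)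
  then have "open ((\<lambda>y. q3_coeff y 4 + fs_weight (dec1 y) (dec2 y)) -` {0<..})" by (rule open_vimage[OF open_greaterThan])
  then show ?thesis by (simp add: flat_domain_def vimage_def)
qed

lemmas smooth_intros = smooth_on_add smooth_on_diff smooth_on_mult smooth_on_scaleR smooth_on_inner
  smooth_on_Re smooth_on_Im smooth_on_cnj smooth_on_of_real smooth_on_const

lemma smooth_on_flatten: "smooth_on (q3_domain i) (flatten i)"
proof (rule smooth_on_q3I[OF open_q3_domain])
  have w: "smooth_on (q3_domain i) (\<lambda>x. of_q3 x $ idx2 i $ idx1 i - fs_weight (q3_coord1 i x) (q3_coord2 i x) *\<^sub>R (q3_coord2 i x * cnj (q3_coord1 i x)))"
    by (intro smooth_intros smooth_on_fs_weight smooth_on_of_q3_nth smooth_on_q3_coord open_q3_domain)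
  note Re_w = smooth_on_Re[OF open_q3_domain w] and Im_w = smooth_on_Im[OF open_q3_domain w]
  show "\<forall>n<8. smooth_on (q3_domain i) (\<lambda>x. q3_coeff (flatten i x) n)"
    unfolding less_8_cases flatten_def Let_def
    by (simp del: minus_complex.simps scaleR_complex.simps, intro conjI Re_w Im_w smooth_intros
      smooth_on_fs_weight smooth_on_of_q3_nth smooth_on_q3_coord open_q3_domain)
qed

lemma smooth_on_unflatten: "smooth_on flat_domain (unflatten i)"
proof -
  have B: "smooth_on flat_domain (\<lambda>y. slice_mat i (dec1 y) (dec2 y) (q3_coeff y 4 + fs_weight (dec1 y) (dec2 y))
      (q3_coeff y 5 + fs_weight (dec1 y) (dec2 y) * (dec1 y \<bullet> dec1 y)) (dec3 y + fs_weight (dec1 y) (dec2 y) *\<^sub>R (dec2 y * cnj (dec1 y))))"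
    by (rule smooth_on_vec_idx[where i = i, OF open_flat_domain];
      rule smooth_on_vec_idx[where i = i, OF open_flat_domain]; unfold slice_mat_nth;
      intro smooth_intros smooth_on_fs_weight smooth_on_coeff smooth_on_dec open_flat_domain)
  show ?thesis
    unfolding unflatten_def Let_def by (rule smooth_on_to_q3[OF open_flat_domain B])
qed

lemma norm_affine_lift: "inverse ((norm (affine_lift i z))\<^sup>2) = fs_weight (z $ 1) (z $ 2)"
  by (simp add: fs_weight_def norm_power2_eq_sum sum_idx[of _ i] power2_norm_eq_inner)

text \<open>On the variety the matrix is \<open>fs_weight\<close> times the \<open>ketbra\<close> of
  the affine lift, whose entries are exactly the values that \<open>flatten\<close>
  subtracts.\<close>

lemma flatten_density_map:
  "flatten i (density_map (line (affine_lift i z))) = enc [Re (z $ 1), Im (z $ 1), Re (z $ 2), Im (z $ 2), 0, 0, 0, 0]"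
proof -
  have s: "of_q3 (density_map (line (affine_lift i z))) = fs_weight (z $ 1) (z $ 2) *\<^sub>R ketbra (affine_lift i z)"
    by (simp add: of_q3_density_map norm_affine_lift)
  have "Re (z $ 1 * cnj (z $ 1)) = z $ 1 \<bullet> z $ 1" by (simp add: inner_complex_def)
  then show ?thesis
    by (simp add: flatten_def Let_def q3_coord_density_map s ketbra_def)
qed

text \<open>If the deviations vanish, the first four coordinates determine a state with those affine
  coordinates, and its flattening is the given point.\<close>

lemma flat_slice:
  "flatten i ` (state_variety \<inter> q3_domain i) = {y. q3_coeff y 4 = 0 \<and> q3_coeff y 5 = 0 \<and> q3_coeff y 6 = 0 \<and> q3_coeff y 7 = 0} \<inter> flat_domain"
    (is "_ = ?T \<inter> _")
proof (intro equalityI subsetI)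
  fix y assume "y \<in> flatten i ` (state_variety \<inter> q3_domain i)"
  then obtain x where x: "x \<in> state_variety" "x \<in> q3_domain i" "y = flatten i x" by auto
  obtain L where L: "L \<in> proj_space" "x = density_map L" using x(1) density_map_image by blast
  then obtain v where v: "v \<noteq> 0" "L = line v" using proj_spaceE by metis
  then have "L \<in> fst (affine_chart i)"
    using x(2) L by (simp add: affine_chart_domain density_map_mem_domain)
  then obtain z where "L = line (affine_lift i z)" by (rule affine_chart_memE)
  then show "y \<in> ?T \<inter> flat_domain"
    using flatten_domain(1)[OF x(2)] by (simp add: x(3) L(2) flatten_density_map)
next
  fix y assume y: "y \<in> ?T \<inter> flat_domain"
  define z :: "complex ^ 2" where "z = vector [dec1 y, dec2 y]"
  have "\<forall>n<8. q3_coeff (flatten i (density_map (line (affine_lift i z)))) n = q3_coeff y n"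
    unfolding less_8_cases flatten_density_map using y by (simp add: z_def dec1_def dec2_def)
  then have "flatten i (density_map (line (affine_lift i z))) = y" by (intro q3_eqI) auto
  moreover have "density_map (line (affine_lift i z)) \<in> state_variety"
    using density_map_image line_in_proj_space affine_lift_nonzero by blast
  moreover have "density_map (line (affine_lift i z)) \<in> q3_domain i"
    by (simp add: density_map_mem_domain)
  ultimately show "y \<in> flatten i ` (state_variety \<inter> q3_domain i)" by blast
qed

definition flat_coords :: "q3 \<Rightarrow> real ^ 4" where
  "flat_coords y = (\<chi> i. if i = 1 then q3_coeff y 0 else if i = 2 then q3_coeff y 1
     else if i = 3 then q3_coeff y 2 else q3_coeff y 3)"

lemma slice_chart_in_atlas:
  "(state_variety \<inter> q3_domain i, \<lambda>x. flat_coords (flatten i x)) \<in> submanifold_atlas state_variety"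
proof -
  let ?T = "{y. q3_coeff y 4 = 0 \<and> q3_coeff y 5 = 0 \<and> q3_coeff y 6 = 0 \<and> q3_coeff y 7 = 0}"
  have sub: "subspace ?T" by (simp add: subspace_def)
  have lin: "linear flat_coords" by (rule linearI) (auto simp: flat_coords_def vec_eq_iff)
  have bij: "bij_betw flat_coords ?T UNIV"
  proof (rule bij_betw_byWitness[where f' = "\<lambda>v. enc [v $ 1, v $ 2, v $ 3, v $ 4, 0, 0, 0, 0]"])
    show "\<forall>y\<in>?T. enc [flat_coords y $ 1, flat_coords y $ 2, flat_coords y $ 3, flat_coords y $ 4, 0, 0, 0, 0] = y"
    proof
      fix y assume y: "y \<in> ?T"
      have "\<forall>n<8. q3_coeff (enc [flat_coords y $ 1, flat_coords y $ 2, flat_coords y $ 3, flat_coords y $ 4, 0, 0, 0, 0]) n = q3_coeff y n"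
        unfolding less_8_cases using y by (simp add: flat_coords_def)
      then show "enc [flat_coords y $ 1, flat_coords y $ 2, flat_coords y $ 3, flat_coords y $ 4, 0, 0, 0, 0] = y"
        by (intro q3_eqI) auto
    qed
    show "\<forall>v\<in>UNIV. flat_coords (enc [v $ 1, v $ 2, v $ 3, v $ 4, 0, 0, 0, 0]) = v"
      by (auto simp: flat_coords_def vec_eq_iff forall_4)
  qed auto
  have 1: "flatten i ` q3_domain i = flat_domain" "unflatten i ` flat_domain = q3_domain i"
    using flatten_domain unflatten_domain by (auto simp: image_iff) metis+
  \<comment> \<open>The witnesses stand for \<open>W\<close>, \<open>W'\<close>, \<open>F\<close>,
    \<open>G\<close>, \<open>T\<close> and \<open>L\<close>, in this order.\<close>
  show ?thesis
    unfolding submanifold_atlas_def mem_Collect_eq split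
    by (rule exI[of _ "q3_domain i"], rule exI[of _ flat_domain], rule exI[of _ "flatten i"],
        rule exI[of _ "unflatten i"], rule exI[of _ ?T], rule exI[of _ flat_coords])
      (simp add: open_q3_domain open_flat_domain 1 flatten_domain unflatten_domain
        smooth_on_flatten smooth_on_unflatten sub lin bij flat_slice)
qed

lemma submanifold_atlas_cover:
  "(\<Union>c\<in>(submanifold_atlas state_variety :: (q3, real ^ 4) chart set). fst c) = state_variety"
proof (intro equalityI subsetI)
  fix y assume y: "y \<in> state_variety"
  then obtain v where v: "v \<noteq> 0" "y = density_map (line v)"
    using density_map_image proj_spaceE by (metis imageE)
  then obtain i where "v $ i \<noteq> 0" by (auto simp: vec_eq_iff)
  then have "y \<in> state_variety \<inter> q3_domain i" using y v by (simp add: density_map_mem_domain)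
  then show "y \<in> (\<Union>c\<in>(submanifold_atlas state_variety :: (q3, real ^ 4) chart set). fst c)"
    using slice_chart_in_atlas[of i] by force
qed (auto simp: submanifold_atlas_def)


section \<open>Curves, fidelity and the main theorem\<close>

lemma density_map_curve:
  fixes \<psi> :: "real \<Rightarrow> complex ^ 3"
  assumes unit: "\<And>s. norm (\<psi> s) = 1" and "(\<psi> has_vector_derivative \<psi>') (at t)"
  shows "\<exists>X. ((\<lambda>s. density_map (line (\<psi> s))) has_vector_derivative X) (at t) \<and>
    (\<Sum>n<8. (q3_coeff X n)\<^sup>2) = 3 * ((norm \<psi>')\<^sup>2 - (cmod (braket (\<psi> t) \<psi>'))\<^sup>2)"
proof -
  have D: "(\<psi> has_derivative (\<lambda>h. h *\<^sub>R \<psi>')) (at t)" using assms(2) by (simp add: has_vector_derivative_def)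
  let ?X = "bloch_vec (ket_bra (\<psi> t) \<psi>' + ket_bra \<psi>' (\<psi> t))"
  have lin: "bloch_vec (ket_bra (\<psi> t) (h *\<^sub>R \<psi>') + ket_bra (h *\<^sub>R \<psi>') (\<psi> t)) = h *\<^sub>R ?X" for h
    by (simp add: bounded_bilinear.scaleR_left[OF bounded_bilinear_ket_bra]
      bounded_bilinear.scaleR_right[OF bounded_bilinear_ket_bra] linear_scale[OF linear_bloch_vec]
      flip: scaleR_right_distrib)
  have "((\<lambda>s. to_q3 (ketbra (\<psi> s))) has_derivative (\<lambda>h. h *\<^sub>R ?X)) (at t)"
    using to_q3_ketbra_has_derivative[OF D] unfolding lin .
  then have "((\<lambda>s. density_map (line (\<psi> s))) has_vector_derivative ?X) (at t)"
    by (simp add: has_vector_derivative_def density_map_unit[OF unit])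
  moreover have "(\<Sum>n<8. (q3_coeff ?X n)\<^sup>2) = 3 * ((norm \<psi>')\<^sup>2 - (cmod (braket (\<psi> t) \<psi>'))\<^sup>2)"
  proof -
    have "Re (braket (\<psi> t) (1 *\<^sub>R \<psi>')) = 0"
      by (rule unit_section_orthogonal[OF D open_UNIV UNIV_I unit])
    then have "?X \<bullet> ?X = 3 * fs_form (\<psi> t) \<psi>' \<psi>'"
      by (intro inner_bloch_vec_ket_bra unit) simp_all
    moreover have "fs_form (\<psi> t) \<psi>' \<psi>' = (norm \<psi>')\<^sup>2 - (cmod (braket (\<psi> t) \<psi>'))\<^sup>2"
    proof -
      have "braket \<psi>' (\<psi> t) * braket (\<psi> t) \<psi>' = of_real ((cmod (braket (\<psi> t) \<psi>'))\<^sup>2)"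
        unfolding cnj_braket[of "\<psi> t" \<psi>', symmetric] complex_norm_square by (simp add: mult.commute)
      then show ?thesis unfolding fs_form_def braket_self by (simp del: of_real_power)
    qed
    ultimately show ?thesis by (simp add: inner_q3_def power2_eq_square)
  qed
  ultimately show ?thesis by blast
qed

text \<open>For projectors \<open>P\<close>, \<open>Q\<close> of trace one,
  \<open>Tr ((P - Q)^2) = 2 - 2 Tr (P Q)\<close>, and \<open>Tr (P Q)\<close> is the fidelity; the
  trace form contributes the factor 3/2.\<close>

lemma dist_density_map:
  assumes "norm \<psi> = 1" "norm \<phi> = 1"
  shows "dist (density_map (line \<psi>)) (density_map (line \<phi>)) = sqrt (3 * (1 - (cmod (braket \<psi> \<phi>))\<^sup>2))"
proof -
  let ?P = "ketbra \<psi>" and ?Q = "ketbra \<phi>"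
  have lt: "linear (\<lambda>A :: complex ^ 3 ^ 3. trace A)"
    using linear_trace_mult[of "mat 1"] by simp
  have tr: "trace ?P = 1" "trace ?Q = 1" by (simp_all add: trace_ketbra assms)
  have PQ: "trace (ketbra a ** ketbra b) = of_real ((cmod (braket a b))\<^sup>2)" for a b
  proof -
    have "trace (ketbra a ** ketbra b) = braket a b * braket b a"
      by (simp add: mult_ketbra ketbra_mult_vector trace_def)
        (simp add: braket_def sum_3 algebra_simps)
    then show ?thesis unfolding complex_norm_square cnj_braket .
  qed
  have sym: "(cmod (braket \<phi> \<psi>))\<^sup>2 = (cmod (braket \<psi> \<phi>))\<^sup>2"
    by (metis cnj_braket complex_mod_cnj)
  have "density_map (line \<psi>) - density_map (line \<phi>) = bloch_vec (?P - ?Q)"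
    by (simp add: density_map_unit assms to_q3_def linear_diff[OF linear_bloch_vec])
  moreover have "bloch_vec (?P - ?Q) \<bullet> bloch_vec (?P - ?Q) = 3 / 2 * Re (trace ((?P - ?Q) ** (?P - ?Q)))"
    by (intro inner_bloch_vec hermitian_diff hermitian_ketbra) (simp_all add: linear_diff[OF lt] tr)
  moreover have "trace ((?P - ?Q) ** (?P - ?Q)) = of_real (2 * (1 - (cmod (braket \<psi> \<phi>))\<^sup>2))"
    by (simp add: linear_diff[OF linear_matrix_mult_left] linear_diff[OF linear_matrix_mult_right]
      linear_diff[OF lt] ketbra_idempotent assms tr PQ sym del: of_real_power)
  ultimately show ?thesis
    by (simp add: dist_norm norm_eq_sqrt_inner del: of_real_mult of_real_diff)
qed

text \<open>The identification of \<open>fubini_study\<close> with a pullback metric is available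
  only at points of the chart domains, so the metrics are compared there and not as
  functions.\<close>

lemma riemannian_metric_cong:
  assumes o: "\<And>c. c \<in> A \<Longrightarrow> open (snd c ` fst c)"
    and eq: "\<And>c p u v. c \<in> A \<Longrightarrow> p \<in> fst c \<Longrightarrow> g c p u v = h c p u v"
    and h: "riemannian_metric A h"
  shows "riemannian_metric A g"
proof -
  have eq': "g c p = h c p" if "c \<in> A" "p \<in> fst c" for c p using eq[OF that] by blast
  have "smooth_on (snd c ` fst c) (\<lambda>y. g c (inv_into (fst c) (snd c) y) u v)" if c: "c \<in> A" for c u v
  proof (rule smooth_on_cong[OF o[OF c]])
    show "smooth_on (snd c ` fst c) (\<lambda>y. h c (inv_into (fst c) (snd c) y) u v)"
      using h c unfolding riemannian_metric_def by (auto simp: split_beta)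
  qed (simp add: eq[OF c] inv_into_into)
  then show ?thesis
    using h unfolding riemannian_metric_def by (auto simp: split_beta eq')
qed

lemma conformal_with_factor_cong:
  assumes "\<And>c p u v. c \<in> A \<Longrightarrow> p \<in> fst c \<Longrightarrow> g c p u v = g' c p u v" "conformal_with_factor k A g' B h f"
  shows "conformal_with_factor k A g B h f"
  using assms unfolding conformal_with_factor_def by auto

lemma smooth_manifold_submanifold:
  fixes A :: "('v::euclidean_space, 'e::euclidean_space) chart set"
  assumes A: "A = submanifold_atlas S" and cover: "(\<Union>c\<in>A. fst c) = S"
  shows "smooth_manifold (top_of_set S) A"
proof -
  have "embedding_map (top_of_set S) euclidean id"
    by (simp add: embedding_map_def homeomorphic_map_id)
  then have "smooth_atlas (top_of_set S) A"
    using smooth_atlas_embedded[OF _ _ _ cover] embedded_chart_submanifold unfolding A by fastforce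
  then show ?thesis
    by (simp add: smooth_manifold_def Hausdorff_space_subtopology Hausdorff_space_euclidean
      second_countable_subtopology second_countable_euclidean)
qed

text \<open>The inverse also becomes the identity in the ambient space, so its smoothness is the
  same transition statement with the roles of the two atlases exchanged.\<close>

lemma diffeomorphism_embedded:
  assumes A: "\<And>c. c \<in> A \<Longrightarrow> embedded_chart f X c" and B: "\<And>d. d \<in> B \<Longrightarrow> embedded_chart id (f ` X) d"
    and T: "topspace T = X" and f: "embedding_map T euclidean f"
  shows "diffeomorphism T A (top_of_set (f ` X)) B f"
proof -
  let ?i = "inv_into X f"
  have hom: "homeomorphic_map T (top_of_set (f ` X)) f" using f T by (simp add: embedding_map_def)
  then obtain g where g: "homeomorphic_maps T (top_of_set (f ` X)) f g" by (metis homeomorphic_map_maps)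
  have inj: "inj_on f X" using homeomorphic_imp_injective_map[OF hom] T by simp
  have cont: "continuous_map (top_of_set (f ` X)) T ?i"
    by (rule continuous_map_eq[where f = g]) (use g T inj in \<open>auto simp: homeomorphic_maps_def\<close>)
  show ?thesis
    unfolding diffeomorphism_def T
  proof (intro conjI)
    show "bij_betw f X (topspace (top_of_set (f ` X)))" using inj by (simp add: bij_betw_def)
    show "smooth_map T A (top_of_set (f ` X)) B f"
      by (rule smooth_map_embedded[OF A B _ homeomorphic_imp_continuous_map[OF hom]]) auto
    show "smooth_map (top_of_set (f ` X)) B T A ?i"
      by (rule smooth_map_embedded[OF B A _ cont]) (auto simp: inj)
  qed
qed

lemma smooth_embedding_embedded:
  assumes A: "\<And>c. c \<in> A \<Longrightarrow> embedded_chart f X c" and f: "embedding_map T euclidean f"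
  shows "smooth_embedding T A euclidean euclidean_atlas f"
proof -
  have "continuous_map T euclidean f"
    using f embedding_map_def homeomorphic_imp_continuous_map continuous_map_into_fulltopology by metis
  then have "smooth_map T A euclidean euclidean_atlas f"
    by (intro smooth_map_embedded[OF A embedded_chart_euclidean]) auto
  moreover have "immersion A euclidean_atlas f"
    by (rule immersion_embedded[OF A embedded_chart_euclidean]) auto
  ultimately show ?thesis using f by (simp add: smooth_embedding_def)
qed

theorem mainTheorem3:
  shows
    "smooth_manifold proj_topology proj_atlas \<and>
     riemannian_metric proj_atlas fubini_study \<and>
     compact state_variety \<and>
     real_algebraic_set state_variety \<and>
     smooth_manifold (top_of_set state_variety)
       (submanifold_atlas state_variety :: (q3, real ^ 4) chart set) \<and>
     riemannian_metric (submanifold_atlas state_variety :: (q3, real ^ 4) chart set)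
       induced_metric \<and>
     smooth_embedding proj_topology proj_atlas
       euclidean (euclidean_atlas :: (q3, q3) chart set) density_map \<and>
     diffeomorphism proj_topology proj_atlas
       (top_of_set state_variety) (submanifold_atlas state_variety :: (q3, real ^ 4) chart set)
       density_map \<and>
     conformal_with_factor 3 proj_atlas fubini_study
       (submanifold_atlas state_variety :: (q3, real ^ 4) chart set) induced_metric density_map \<and>
     (\<forall>(\<psi> :: real \<Rightarrow> complex ^ 3) \<psi>' t.
        (\<forall>s. norm (\<psi> s) = 1) \<and> (\<psi> has_vector_derivative \<psi>') (at t) \<longrightarrow>
        (\<exists>X. ((\<lambda>s. density_map (line (\<psi> s))) has_vector_derivative X) (at t) \<and>
             (\<Sum>n<8. (q3_coeff X n)\<^sup>2) = 3 * ((norm \<psi>')\<^sup>2 - (cmod (braket (\<psi> t) \<psi>'))\<^sup>2))) \<and>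
     (\<exists>f :: real \<Rightarrow> real. strict_antimono_on {0..1} f \<and>
        (\<forall>\<psi> \<phi> :: complex ^ 3. norm \<psi> = 1 \<and> norm \<phi> = 1 \<longrightarrow>
           dist (density_map (line \<psi>)) (density_map (line \<phi>)) = f ((cmod (braket \<psi> \<phi>))\<^sup>2)))"
proof (intro conjI)
  let ?V = "submanifold_atlas state_variety :: (q3, real ^ 4) chart set"
  show "riemannian_metric proj_atlas fubini_study"
    by (rule riemannian_metric_cong[OF embedded_chart_open[OF embedded_chart_proj_atlas]
        fubini_study_affine_chart riemannian_metric_pullback[OF embedded_chart_proj_atlas]]) auto
  show "smooth_manifold (top_of_set state_variety) ?V"
    by (rule smooth_manifold_submanifold[OF refl submanifold_atlas_cover])
  show "riemannian_metric ?V induced_metric"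
    unfolding induced_metric_eq_pullback
    by (rule riemannian_metric_pullback[OF embedded_chart_submanifold]) auto
  show "smooth_embedding proj_topology proj_atlas euclidean euclidean_atlas density_map"
    by (rule smooth_embedding_embedded[OF embedded_chart_proj_atlas embedding_map_density_map])
  show "diffeomorphism proj_topology proj_atlas (top_of_set state_variety) ?V density_map"
    using diffeomorphism_embedded[where B = ?V, OF embedded_chart_proj_atlas _ topspace_proj_topology embedding_map_density_map]
      embedded_chart_submanifold unfolding density_map_image by blast
  \<comment> \<open>The product \<open>3 * (1 / 3)\<close> is the factor 1 of the induced
    metric.\<close>
  have "conformal_with_factor 3 proj_atlas (pullback_metric (1 / 3) density_map) ?V (pullback_metric (3 * (1 / 3)) id) density_map"
    by (rule conformal_pullback[OF embedded_chart_proj_atlas embedded_chart_submanifold])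
      (auto simp flip: density_map_image)
  then show "conformal_with_factor 3 proj_atlas fubini_study ?V induced_metric density_map"
    unfolding induced_metric_eq_pullback
    by (intro conformal_with_factor_cong[OF fubini_study_affine_chart]) simp_all
  show "\<forall>(\<psi> :: real \<Rightarrow> complex ^ 3) \<psi>' t.
        (\<forall>s. norm (\<psi> s) = 1) \<and> (\<psi> has_vector_derivative \<psi>') (at t) \<longrightarrow>
        (\<exists>X. ((\<lambda>s. density_map (line (\<psi> s))) has_vector_derivative X) (at t) \<and>
             (\<Sum>n<8. (q3_coeff X n)\<^sup>2) = 3 * ((norm \<psi>')\<^sup>2 - (cmod (braket (\<psi> t) \<psi>'))\<^sup>2))"
    using density_map_curve by blast
  \<comment> \<open>The function is read off from \<open>dist_density_map\<close>: distance
    decreases strictly as fidelity grows.\<close>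
  show "\<exists>f :: real \<Rightarrow> real. strict_antimono_on {0..1} f \<and>
        (\<forall>\<psi> \<phi> :: complex ^ 3. norm \<psi> = 1 \<and> norm \<phi> = 1 \<longrightarrow>
           dist (density_map (line \<psi>)) (density_map (line \<phi>)) = f ((cmod (braket \<psi> \<phi>))\<^sup>2))"
  proof (intro exI[of _ "\<lambda>F. sqrt (3 * (1 - F))"] conjI allI impI)
    show "strict_antimono_on {0..1} (\<lambda>F :: real. sqrt (3 * (1 - F)))" by (rule monotone_onI) simp
  qed (simp add: dist_density_map)
qed (rule smooth_manifold_proj compact_state_variety real_algebraic_state_variety)+

end
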